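(* Let $d\ge 1$ be an integer and let $v_d$ denote the Lebesgue measure (volume) of the unit ball of $\mathbb{R}^d$. Let $\lambda_e^{ball}$ and $\lambda_e^{box}$ be the critical values of the existence phase transition of the fractal ball model and of the fractal box model in $\mathbb{R}^d$, respectively, and let $\mathcal{C}^{ball}(\lambda)$ and $\mathcal{C}^{box}(\lambda)$ be the corresponding random fractals at intensity $\lambda$. Then $\lambda_e^{ball}=d/v_d$ and $\lambda_e^{box}=d$. Furthermore, $$\mathbb{P}\big(\mathcal{C}^{box}(\lambda_e^{box})=\emptyset\big)=\mathbb{P}\big(\mathcal{C}^{ball}(\lambda_e^{ball})=\emptyset\big)=1.$$
   Context: Let $\nu$ be the measure on $(0,1]$ given by $\nu(dr)=r^{-d-1}\,dr$, and let $\mu=dx\times\nu$ be the product measure on $\mathbb{R}^d\times(0,1]$, where $dx$ is $d$-dimensional Lebesgue measure. For $0<\lambda<\infty$, let $\Phi_\lambda=\Phi_\lambda(\mu)$ be a Poisson process on $\mathbb{R}^d\times(0,1]$ with intensity measure $\lambda\mu$. Fractal ball model: to each $(x,r)\in\mathbb{R}^d\times(0,1]$ associate the open Euclidean ball $B(x,r)$ centered at $x$ with radius $r$, and set $$\mathcal{C}^{ball}(\lambda):=\mathbb{R}^d\setminus\bigcup_{(x,r)\in\Phi_\lambda}B(x,r).$$ Fractal box model: to each $(x,r)\in\mathbb{R}^d\times(0,1]$ associate the open box $X(x,r):=x+(-r/2,r/2)^d$, and set $$\mathcal{C}^{box}(\lambda):=\mathbb{R}^d\setminus\bigcup_{(x,r)\in\Phi_\lambda}X(x,r).$$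 Critical values: for each of the two models, $$\lambda_e:=\inf\{\lambda>0:\ \mathbb{P}(\mathcal{C}(\lambda)=\emptyset)=1\},$$ where $\mathcal{C}(\lambda)$ is $\mathcal{C}^{ball}(\lambda)$ (giving $\lambda_e^{ball}$) or $\mathcal{C}^{box}(\lambda)$ (giving $\lambda_e^{box}$). *)

theory Defs
  imports "HOL-Probability.Probability"
begin

text \<open>
  A Poisson process is rendered as a random countable subset of its state space. This loses
  nothing when the intensity measure \<open>S\<close> is diffuse, since the process is then almost surely
  simple; for an \<open>S\<close> with atoms no such process exists. Counts take values in \<^typ>\<open>ennreal\<close>
  because they may be infinite.
\<close>

definition point_count :: "('w \<Rightarrow> 'a set) \<Rightarrow> 'a set \<Rightarrow> 'w \<Rightarrow> ennreal" where
  "point_count \<Phi> A \<omega> = emeasure (count_space UNIV) (\<Phi> \<omega> \<inter> A)"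

locale poisson_process = prob_space M
  for M :: "'w measure" and \<Phi> :: "'w \<Rightarrow> 'a set" and S :: "'a measure" +
  assumes countable_points: "\<omega> \<in> space M \<Longrightarrow> countable (\<Phi> \<omega>)"
    and points_in_space: "\<omega> \<in> space M \<Longrightarrow> \<Phi> \<omega> \<subseteq> space S"
    and measurable_count: "A \<in> sets S \<Longrightarrow> point_count \<Phi> A \<in> borel_measurable M"
    and poisson_count:
      "A \<in> sets S \<Longrightarrow> emeasure S A < \<infinity> \<Longrightarrow>
        prob {\<omega> \<in> space M. point_count \<Phi> A \<omega> = of_nat k} =
          exp (- measure S A) * measure S A ^ k / fact k"
    and infinite_count:
      "A \<in> sets S \<Longrightarrow> emeasure S A = \<infinity> \<Longrightarrow> AE \<omega> in M. point_count \<Phi> A \<omega> = \<infinity>"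
    and indep_counts:
      "(\<And>i. i < n \<Longrightarrow> B i \<in> sets S) \<Longrightarrow> disjoint_family_on B {..<n} \<Longrightarrow>
        indep_vars (\<lambda>_. borel) (\<lambda>i. point_count \<Phi> (B i)) {..<(n::nat)}"

definition radius_measure :: "nat \<Rightarrow> real measure" where
  "radius_measure d =
    density (restrict_space lborel {0<..1}) (\<lambda>r. ennreal (r powr (- real d - 1)))"

definition fractal_measure :: "((real ^ 'n) \<times> real) measure" where
  "fractal_measure = lborel \<Otimes>\<^sub>M radius_measure CARD('n)"

definition centred_box :: "real ^ 'n \<Rightarrow> real \<Rightarrow> (real ^ 'n) set" where
  "centred_box x r = (+) x ` box (\<chi> i. - r / 2) (\<chi> i. r / 2)"

definition ball_fractal :: "((real ^ 'n) \<times> real) set \<Rightarrow> (real ^ 'n) set" where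
  "ball_fractal P = UNIV - (\<Union>(x, r)\<in>P. ball x r)"

definition box_fractal :: "((real ^ 'n) \<times> real) set \<Rightarrow> (real ^ 'n) set" where
  "box_fractal P = UNIV - (\<Union>(x, r)\<in>P. centred_box x r)"

text \<open>
  In the following, \<open>C l \<omega>\<close> is the random set at intensity \<open>l\<close>, defined on the probability space
  \<open>M l\<close>; spaces for different intensities need not be related. The infimum is the one of
  \<^typ>\<open>real\<close>, so it is meaningful only when the set is nonempty.
\<close>

definition existence_critical_value ::
    "(real \<Rightarrow> 'w measure) \<Rightarrow> (real \<Rightarrow> 'w \<Rightarrow> 'a set) \<Rightarrow> real" where
  "existence_critical_value M C = Inf {l. 0 < l \<and> \<P>(\<omega> in M l. C l \<omega> = {}) = 1}"

definition lambda_e_ball ::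
    "(real \<Rightarrow> 'w measure) \<Rightarrow> (real \<Rightarrow> 'w \<Rightarrow> ((real ^ 'n) \<times> real) set) \<Rightarrow> real" where
  "lambda_e_ball M \<Phi> = existence_critical_value M (\<lambda>l \<omega>. ball_fractal (\<Phi> l \<omega>))"

definition lambda_e_box ::
    "(real \<Rightarrow> 'w measure) \<Rightarrow> (real \<Rightarrow> 'w \<Rightarrow> ((real ^ 'n) \<times> real) set) \<Rightarrow> real" where
  "lambda_e_box M \<Phi> = existence_critical_value M (\<lambda>l \<omega>. box_fractal (\<Phi> l \<omega>))"

end

theory Submission
  imports Defs
begin

text \<open>
  Both models cover space with the open balls \<open>{y. \<nu> (y - x) < r}\<close> of a norm \<open>\<nu>\<close>, which is the Euclidean
  norm or twice the maximum norm. If \<open>V\<close> is the volume of the unit ball of \<open>\<nu>\<close>, a given point is left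
  uncovered by the balls of radius greater than \<open>\<epsilon>\<close> with probability \<open>\<epsilon> powr (l * V)\<close>. For
  \<open>l * V < d\<close>, the second moment of the number of points of the grid of mesh \<open>2 ^ -n\<close> that are uncovered by
  the balls of radius greater than \<open>2 ^ -n\<close> is at most a constant times the square of its mean, so
  such points exist with probability bounded away from \<open>0\<close>, and by compactness a point of the unit
  cube remains uncovered with positive probability.

  For \<open>l * V = d\<close>, the expected number of dyadic cubes of side \<open>2 ^ -n\<close> in a unit cube that are not contained in a
  single ball of radius much greater than \<open>2 ^ -n\<close> is bounded in \<open>n\<close>. If at most \<open>K\<close> such cubes are left, then
  independently of the larger balls all of them are covered by balls of radius of order \<open>2 ^ -n\<close>
  with probability at least \<open>p ^ K\<close>. The probabilities of extinction by level \<open>n\<close> increase with \<open>n\<close>, so their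
  increments tend to \<open>0\<close>; hence so does the probability that between \<open>1\<close> and \<open>K\<close> cubes are left, and by Markov's
  inequality all cubes eventually die.
\<close>

section \<open>Void probabilities and independence\<close>

context poisson_process
begin

definition void :: "'a set \<Rightarrow> 'w set" where
  "void A = {\<omega> \<in> space M. \<Phi> \<omega> \<inter> A = {}}"

lemma void_conv_point_count: "void A = {\<omega> \<in> space M. point_count \<Phi> A \<omega> = 0}"
  by (auto simp: void_def point_count_def emeasure_count_space_eq_0)

lemma void_sets [measurable]: "A \<in> sets S \<Longrightarrow> void A \<in> events"
  using measurable_count[of A] unfolding void_conv_point_count by measurable

lemma void_subset_space: "void A \<subseteq> space M"
  by (auto simp: void_def)

lemma prob_void:
  assumes "A \<in> sets S" "emeasure S A < \<infinity>"
  shows "prob (void A) = exp (- measure S A)"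
  using poisson_count[OF assms, of 0] unfolding void_conv_point_count by simp

lemma void_Un: "void A \<inter> void B = void (A \<union> B)"
  by (auto simp: void_def)

lemma void_UN: "I \<noteq> {} \<Longrightarrow> (\<Inter>i\<in>I. void (A i)) = void (\<Union>i\<in>I. A i)"
  by (auto simp: void_def)

text \<open>Void probabilities are exponentials of minus a measure, so additivity of the measure on
  disjoint sets turns directly into multiplication of probabilities.\<close>

lemma prob_void_Int:
  assumes "A \<in> sets S" "emeasure S A < \<infinity>" "B \<in> sets S" "emeasure S B < \<infinity>" "A \<inter> B = {}"
  shows "prob (void A \<inter> void B) = prob (void A) * prob (void B)"
proof -
  have "emeasure S (A \<union> B) < \<infinity>"
    using assms plus_emeasure[of A S B] by (simp flip: plus_emeasure)
  moreover have "measure S (A \<union> B) = measure S A + measure S B"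
    using assms by (intro measure_Union) auto
  ultimately show ?thesis
    using assms by (simp add: void_Un prob_void exp_add[symmetric])
qed

lemma void_antimono: "A \<subseteq> B \<Longrightarrow> void B \<subseteq> void A"
  by (auto simp: void_def)

text \<open>A \<pi>-system that generates the events decided by the points in \<open>R\<close>.
  Finite intensity is demanded so that \<open>prob_void\<close> gives the probability of each
  generator.\<close>

definition void_events :: "'a set \<Rightarrow> 'w set set" where
  "void_events R = {void A | A. A \<in> sets S \<and> A \<subseteq> R \<and> emeasure S A < \<infinity>}"

lemma void_eventsI: "A \<in> sets S \<Longrightarrow> A \<subseteq> R \<Longrightarrow> emeasure S A < \<infinity> \<Longrightarrow> void A \<in> void_events R"
  by (auto simp: void_events_def)

lemma Int_stable_void_events: "Int_stable (void_events R)"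
proof (rule Int_stableI)
  fix a b assume "a \<in> void_events R" "b \<in> void_events R"
  then obtain A B where *: "a = void A" "b = void B" "A \<in> sets S" "B \<in> sets S" "A \<subseteq> R" "B \<subseteq> R"
    "emeasure S A < \<infinity>" "emeasure S B < \<infinity>"
    by (auto simp: void_events_def)
  have "emeasure S (A \<union> B) \<le> emeasure S A + emeasure S B"
    using * by (intro emeasure_subadditive)
  also have "\<dots> < \<infinity>" using * by simp
  finally show "a \<inter> b \<in> void_events R"
    using * by (auto simp: void_Un intro!: void_eventsI)
qed

text \<open>On disjoint regions the probabilities of void events multiply, because the intensities
  add up in the exponent. Stability under intersection extends this from the generators to the
  generated \<sigma>-algebras.\<close>

lemma indep_sets_void_events:
  assumes disj: "disjoint_family_on R I"
  shows "indep_sets (\<lambda>i. sigma_sets (space M) (void_events (R i))) I"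
proof (rule indep_sets_sigma)
  show "indep_sets (\<lambda>i. void_events (R i)) I"
  proof (rule indep_setsI)
    fix i assume "i \<in> I"
    show "void_events (R i) \<subseteq> events"
      by (auto simp: void_events_def)
  next
    fix E J assume J: "J \<noteq> {}" "J \<subseteq> I" "finite J" and E: "\<forall>j\<in>J. E j \<in> void_events (R j)"
    from E have "\<forall>j\<in>J. \<exists>A. E j = void A \<and> A \<in> sets S \<and> A \<subseteq> R j \<and> emeasure S A < \<infinity>"
      by (auto simp: void_events_def)
    then obtain A where A: "\<And>j. j \<in> J \<Longrightarrow> E j = void (A j) \<and> A j \<in> sets S \<and> A j \<subseteq> R j \<and> emeasure S (A j) < \<infinity>"
      by metis
    have dA: "disjoint_family_on A J"
      using disj A J(2) unfolding disjoint_family_on_def by blast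
    have UA: "(\<Union>j\<in>J. A j) \<in> sets S" using A J(3) by auto
    have "emeasure S (\<Union>j\<in>J. A j) = (\<Sum>j\<in>J. emeasure S (A j))"
      using A dA J(3) by (intro sum_emeasure[symmetric]) auto
    also have "\<dots> < \<infinity>" using A J(3) by auto
    finally have fin: "emeasure S (\<Union>j\<in>J. A j) < \<infinity>" .
    have "(\<Inter>j\<in>J. E j) = void (\<Union>j\<in>J. A j)"
      using A J(1) by (subst void_UN[symmetric]) auto
    then have "prob (\<Inter>j\<in>J. E j) = exp (- measure S (\<Union>j\<in>J. A j))"
      using prob_void[OF UA fin] by simp
    also have "measure S (\<Union>j\<in>J. A j) = (\<Sum>j\<in>J. measure S (A j))"
      using A dA J(3) by (intro measure_finite_Union) (auto simp: less_top)
    also have "exp (- \<dots>) = (\<Prod>j\<in>J. prob (E j))"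
      using A J(3) by (simp add: sum_negf[symmetric] exp_sum prob_void)
    finally show "prob (\<Inter>j\<in>J. E j) = (\<Prod>j\<in>J. prob (E j))" .
  qed
qed (rule Int_stable_void_events)

text \<open>This is the form of independence used for one step of extinction: \<open>F\<close>
  records what the larger balls do, and the regions \<open>H k\<close> are to be hit by smaller
  ones.\<close>

lemma prob_Int_not_void:
  assumes V: "finite V" and F: "F \<in> sigma_sets (space M) (void_events R)"
    and H: "\<And>k. k \<in> V \<Longrightarrow> H k \<in> sets S" "\<And>k. k \<in> V \<Longrightarrow> emeasure S (H k) < \<infinity>"
    and disj: "disjoint_family_on H V" "\<And>k. k \<in> V \<Longrightarrow> R \<inter> H k = {}"
  shows "prob (F \<inter> (\<Inter>k\<in>V. space M - void (H k))) = prob F * (\<Prod>k\<in>V. 1 - prob (void (H k)))"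
proof -
  \<comment> \<open>The index \<open>None\<close> stands for \<open>R\<close> with its event
    \<open>F\<close>, the index \<open>Some k\<close> for \<open>H k\<close> with the event that it
    is hit.\<close>
  define I where "I = insert None (Some ` V)"
  define Reg where "Reg = case_option R H"
  define E where "E = case_option F (\<lambda>k. space M - void (H k))"
  have "disjoint_family_on Reg I"
    using disj unfolding disjoint_family_on_def I_def Reg_def by auto
  from indep_sets_void_events[OF this]
  have "prob (\<Inter>j\<in>I. E j) = (\<Prod>j\<in>I. prob (E j))"
  proof (rule indep_setsD)
    have "space M - void (H k) \<in> sigma_sets (space M) (void_events (H k))" if "k \<in> V" for k
      using H[OF that] by (intro sigma_sets.Compl sigma_sets.Basic void_eventsI) auto
    then show "\<forall>j\<in>I. E j \<in> sigma_sets (space M) (void_events (Reg j))"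
      using F by (auto simp: I_def E_def Reg_def)
  qed (use V in \<open>auto simp: I_def\<close>)
  also have "(\<Inter>j\<in>I. E j) = F \<inter> (\<Inter>k\<in>V. space M - void (H k))"
    by (auto simp: I_def E_def)
  also have "(\<Prod>j\<in>I. prob (E j)) = prob F * (\<Prod>k\<in>V. prob (space M - void (H k)))"
    unfolding I_def using V by (subst prod.insert) (auto simp: E_def prod.reindex)
  also have "(\<Prod>k\<in>V. prob (space M - void (H k))) = (\<Prod>k\<in>V. 1 - prob (void (H k)))"
    using H by (intro prod.cong refl prob_compl void_sets)
  finally show ?thesis .
qed

end

section \<open>Intensities of cones\<close>

lemma id_measurable_radius_measure [measurable]: "(\<lambda>r. r) \<in> radius_measure d \<rightarrow>\<^sub>M borel"
proof -
  have "(\<lambda>r. r) \<in> restrict_space lborel {0<..1::real} \<rightarrow>\<^sub>M borel"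
    by (rule measurable_restrict_space1) simp
  then show ?thesis
    by (simp add: radius_measure_def)
qed

lemma space_radius_measure: "space (radius_measure d) = {0<..1}"
  by (simp add: radius_measure_def space_restrict_space)

lemma nn_integral_radius_measure:
  assumes "f \<in> borel_measurable (radius_measure d)"
  shows "(\<integral>\<^sup>+r. f r \<partial>radius_measure d) =
    (\<integral>\<^sup>+r. ennreal (r powr (- real d - 1)) * f r * indicator {0<..1} r \<partial>lborel)"
proof -
  have f: "f \<in> borel_measurable (restrict_space lborel {0<..1})"
    using assms by (simp add: radius_measure_def)
  have p: "(\<lambda>r. ennreal (r powr (- real d - 1))) \<in> borel_measurable (restrict_space lborel {0<..1})"
    by (rule measurable_restrict_space1) simp
  show ?thesis
    unfolding radius_measure_def using f p
    by (subst nn_integral_density) (auto simp: nn_integral_restrict_space)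
qed

lemma sigma_finite_radius_measure: "sigma_finite_measure (radius_measure d)"
proof -
  interpret R: sigma_finite_measure "restrict_space lborel {0<..1::real}"
    by (rule sigma_finite_measure_restrict_space) (auto simp: sigma_finite_lborel)
  have "(\<lambda>r. ennreal (r powr (- real d - 1))) \<in> borel_measurable (restrict_space lborel {0<..1})"
    by (rule measurable_restrict_space1) simp
  then show ?thesis
    unfolding radius_measure_def by (subst R.sigma_finite_iff_density_finite) auto
qed

lemma space_fractal_measure: "space fractal_measure = UNIV \<times> {0<..1}"
  by (simp add: fractal_measure_def space_pair_measure space_radius_measure)

lemma fst_measurable_fractal_measure [measurable]: "fst \<in> fractal_measure \<rightarrow>\<^sub>M borel"
  unfolding fractal_measure_def by (rule measurable_fst'') simp

lemma snd_measurable_fractal_measure [measurable]: "snd \<in> fractal_measure \<rightarrow>\<^sub>M borel"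
  unfolding fractal_measure_def by (rule measurable_snd'') simp

text \<open>Both factors are \<sigma>-finite, so the measure can be computed by slicing at fixed
  radius. All intensities below are thereby one-dimensional integrals of volumes of slices.\<close>

lemma emeasure_fractal_measure:
  fixes A :: "((real ^ 'n) \<times> real) set"
  assumes A: "A \<in> sets fractal_measure"
  shows "emeasure fractal_measure A =
    (\<integral>\<^sup>+r. ennreal (r powr (- real CARD('n) - 1)) * emeasure lborel {x. (x, r) \<in> A} * indicator {0<..1} r \<partial>lborel)"
proof -
  interpret pair_sigma_finite "lborel :: (real^'n) measure" "radius_measure CARD('n)"
    by (simp add: pair_sigma_finite_def sigma_finite_lborel sigma_finite_radius_measure)
  have A': "A \<in> sets ((lborel :: (real^'n) measure) \<Otimes>\<^sub>M radius_measure CARD('n))"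
    using A unfolding fractal_measure_def .
  have m: "(\<lambda>r. emeasure lborel ((\<lambda>x. (x, r)) -` A)) \<in> borel_measurable (radius_measure CARD('n))"
    by (rule measurable_emeasure_Pair2[OF A'])
  show ?thesis
    unfolding fractal_measure_def emeasure_pair_measure_alt2[OF A'] nn_integral_radius_measure[OF m]
    by (simp add: vimage_def)
qed

text \<open>Definiteness is encoded by the comparison with \<open>infnorm\<close>, whose constants
  are used quantitatively: \<open>b\<close> bounds the \<open>\<nu>\<close>-size of grid cubes from
  above, and \<open>a\<close> bounds the \<open>\<nu>\<close>-distance of grid points from
  below.\<close>

locale general_norm =
  fixes \<nu> :: "real ^ 'n \<Rightarrow> real" and a b :: real
  assumes triangle: "\<nu> (x + y) \<le> \<nu> x + \<nu> y"
    and scaleR: "\<nu> (c *\<^sub>R x) = \<bar>c\<bar> * \<nu> x"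
    and infnorm_le: "infnorm x \<le> a * \<nu> x"
    and le_infnorm: "\<nu> x \<le> b * infnorm x"
begin

section \<open>Norms and the volumes of their balls\<close>

lemma zero [simp]: "\<nu> 0 = 0"
  using scaleR[of 0 0] by simp

lemma minus [simp]: "\<nu> (- x) = \<nu> x"
  using scaleR[of "-1" x] by simp

lemma commute: "\<nu> (x - y) = \<nu> (y - x)"
  using minus[of "x - y"] by simp

lemma nonneg [simp]: "0 \<le> \<nu> x"
  using triangle[of x "- x"] by simp

lemma triangle_diff: "\<nu> (x - z) \<le> \<nu> (x - y) + \<nu> (y - z)"
  using triangle[of "x - y" "y - z"] by simp

lemma constants_pos: "0 < a" "0 < b"
proof -
  have 1: "0 < infnorm (1 :: real^'n)" by (simp add: infnorm_pos_lt)
  show "0 < a"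
    using infnorm_le[of 1] 1 nonneg[of 1] by (smt (verit) mult_nonneg_nonneg mult_nonpos_nonneg)
  have "0 < \<nu> 1"
    using infnorm_le[of 1] 1 nonneg[of 1] by (metis less_eq_real_def less_le_not_le mult_zero_right)
  then show "0 < b"
    using le_infnorm[of 1] 1 by (smt (verit) mult_nonpos_nonneg)
qed

lemma Lipschitz: "\<bar>\<nu> x - \<nu> y\<bar> \<le> b * norm (x - y)"
proof -
  have "\<nu> x \<le> \<nu> y + \<nu> (x - y)" "\<nu> y \<le> \<nu> x + \<nu> (x - y)"
    using triangle[of y "x - y"] triangle[of x "y - x"] commute[of x y] by simp_all
  moreover have "\<nu> (x - y) \<le> b * norm (x - y)"
    using le_infnorm[of "x - y"] infnorm_le_norm[of "x - y"] constants_pos(2)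
    by (smt (verit) mult_left_mono)
  ultimately show ?thesis by linarith
qed

lemma continuous_nu: "continuous_on UNIV \<nu>"
proof (rule continuous_onI)
  fix x :: "real^'n" and e :: real assume "e > 0"
  then show "\<exists>d>0. \<forall>x'\<in>UNIV. dist x' x < d \<longrightarrow> dist (\<nu> x') (\<nu> x) \<le> e"
    using constants_pos(2)
    by (intro exI[of _ "e / b"])
      (auto simp: dist_norm field_simps intro!: order.trans[OF Lipschitz])
qed

lemma borel_measurable_nu [measurable]: "\<nu> \<in> borel_measurable borel"
  by (rule borel_measurable_continuous_onI[OF continuous_nu])

lemma open_nu_ball: "open {x. \<nu> (x - z) < r}"
  by (intro open_Collect_less continuous_on_compose2[OF continuous_nu] continuous_intros) auto

definition volume :: real where
  "volume = measure lborel {x. \<nu> x < 1}"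

lemma bounded_unit_ball: "bounded {x. \<nu> x < 1}"
proof (rule boundedI)
  fix x assume "x \<in> {x. \<nu> x < 1}"
  then have "a * \<nu> x \<le> a * 1" using constants_pos by (intro mult_left_mono) auto
  then have "infnorm x \<le> a" using infnorm_le[of x] by simp
  then show "norm x \<le> sqrt DIM(real^'n) * a"
    by (intro order.trans[OF norm_le_infnorm]) (simp add: mult_left_mono)
qed

lemma emeasure_unit_ball: "emeasure lborel {x. \<nu> x < 1} = ennreal volume"
  unfolding volume_def
  using emeasure_bounded_finite[OF bounded_unit_ball] by (simp add: emeasure_eq_ennreal_measure less_top)

lemma volume_pos: "0 < volume"
proof -
  have "open {x. \<nu> x < 1}" using open_nu_ball[of 0 1] by simp
  moreover have "0 \<in> {x. \<nu> x < 1}" by simp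
  ultimately have "\<not> negligible {x. \<nu> x < 1}"
    using open_not_negligible by blast
  then have "emeasure lborel {x. \<nu> x < 1} \<noteq> 0"
    using \<open>open {x. \<nu> x < 1}\<close> null_sets_completionI[of "{x. \<nu> x < 1}" lborel]
    by (auto simp: negligible_iff_null_sets null_sets_def borel_open)
  then show ?thesis unfolding emeasure_unit_ball by (simp add: ennreal_eq_0_iff not_le)
qed

lemma emeasure_nu_ball:
  assumes "0 \<le> r"
  shows "emeasure lborel {x. \<nu> (x - z) < r} = ennreal (r ^ CARD('n) * volume)"
proof (cases "r = 0")
  case True
  have "{x. \<nu> (x - z) < 0} = {}" using nonneg by (auto simp: not_less)
  then show ?thesis using True by (simp add: power_0_left)
next
  case False
  with assms have r: "r > 0" by simp
  have "{x. \<nu> (x - z) < r} = (\<lambda>x. r *\<^sub>R x + z) ` {x. \<nu> x < 1}"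
  proof (intro equalityI subsetI)
    fix x assume "x \<in> {x. \<nu> (x - z) < r}"
    then have "(1 / r) *\<^sub>R (x - z) \<in> {x. \<nu> x < 1}" using r by (simp only: mem_Collect_eq scaleR) (simp add: field_simps)
    moreover have "x = r *\<^sub>R ((1 / r) *\<^sub>R (x - z)) + z" using r by simp
    ultimately show "x \<in> (\<lambda>x. r *\<^sub>R x + z) ` {x. \<nu> x < 1}" by (metis image_eqI)
  qed (use r in \<open>auto simp: scaleR\<close>)
  then have "emeasure lebesgue {x. \<nu> (x - z) < r} = ennreal (r ^ CARD('n) * volume)"
    using r emeasure_unit_ball open_nu_ball[of 0 1]
    volume_pos by (simp add: emeasure_lebesgue_affine ennreal_mult ennreal_power borel_open)
  then show ?thesis using open_nu_ball[of z r] by (simp add: borel_open)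
qed

text \<open>For \<open>\<delta> = 0\<close> these are the balls that contain \<open>z\<close>, with
  radius in the window from \<open>\<epsilon>\<close> to \<open>t\<close>. For positive
  \<open>\<delta>\<close> the balls contain all points within \<open>\<nu>\<close>-distance
  \<open>\<delta>\<close> of \<open>z\<close>, by the triangle inequality.\<close>

definition cone :: "real ^ 'n \<Rightarrow> real \<Rightarrow> real \<Rightarrow> real \<Rightarrow> ((real ^ 'n) \<times> real) set" where
  "cone z \<delta> \<epsilon> t = {(x, r). \<nu> (x - z) + \<delta> < r \<and> \<epsilon> < r \<and> r \<le> t}"

lemma cone_sets [measurable]:
  assumes "0 \<le> \<epsilon>" "t \<le> 1"
  shows "cone z \<delta> \<epsilon> t \<in> sets fractal_measure"
proof -
  have "cone z \<delta> \<epsilon> t =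
    {p \<in> space fractal_measure. \<nu> (fst p - z) + \<delta> < snd p \<and> \<epsilon> < snd p \<and> snd p \<le> t}"
    using assms by (auto simp: cone_def space_fractal_measure)
  also have "\<dots> \<in> sets fractal_measure" by measurable
  finally show ?thesis .
qed

text \<open>The slice at radius \<open>r\<close> has volume \<open>volume * r ^ d\<close>, which
  reduces the density \<open>r powr (- d - 1)\<close> to \<open>1 / r\<close>. The logarithm
  expresses the scale invariance of the model.\<close>

lemma emeasure_cone:
  assumes "0 < \<epsilon>" "\<epsilon> \<le> t" "t \<le> 1"
  shows "emeasure fractal_measure (cone z 0 \<epsilon> t) = ennreal (volume * ln (t / \<epsilon>))"
proof -
  let ?d = "CARD('n)"
  have "emeasure fractal_measure (cone z 0 \<epsilon> t) =
    (\<integral>\<^sup>+r. ennreal (r powr (- real ?d - 1)) * emeasure lborel {x. (x, r) \<in> cone z 0 \<epsilon> t} * indicator {0<..1} r \<partial>lborel)"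
    using assms by (intro emeasure_fractal_measure cone_sets) auto
  also have "\<dots> = (\<integral>\<^sup>+r. ennreal (volume / r) * indicator {\<epsilon>..t} r \<partial>lborel)"
  proof (rule nn_integral_cong_AE)
    have *: "ennreal (r powr (- real ?d - 1)) * emeasure lborel {x. (x, r) \<in> cone z 0 \<epsilon> t} * indicator {0<..1} r =
       ennreal (volume / r) * indicator {\<epsilon>..t} r" if "r \<noteq> \<epsilon>" for r
    proof (cases "\<epsilon> < r \<and> r \<le> t")
      case True
      then have r: "0 < r" "r \<le> 1" using assms by auto
      have "{x. (x, r) \<in> cone z 0 \<epsilon> t} = {x. \<nu> (x - z) < r}" using True by (auto simp: cone_def)
      then have "emeasure lborel {x. (x, r) \<in> cone z 0 \<epsilon> t} = ennreal (r ^ ?d * volume)"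
        using r by (simp add: emeasure_nu_ball)
      moreover have "r powr (- real ?d - 1) * (r ^ ?d * volume) = volume / r"
        using r by (simp add: powr_diff powr_minus powr_realpow field_simps)
      ultimately show ?thesis using True r by (simp add: ennreal_mult'[symmetric])
    next
      case False
      then have "{x. (x, r) \<in> cone z 0 \<epsilon> t} = {}" by (auto simp: cone_def)
      then show ?thesis using False that by (auto simp: indicator_def)
    qed
    \<comment> \<open>The cone excludes the radius \<open>\<epsilon>\<close>, whereas the integral
      to be evaluated runs over a closed interval; the two integrands may differ at this one
      point.\<close>
    show "AE r in lborel. ennreal (r powr (- real ?d - 1)) * emeasure lborel {x. (x, r) \<in> cone z 0 \<epsilon> t} * indicator {0<..1} r =
       ennreal (volume / r) * indicator {\<epsilon>..t} r"
      using AE_lborel_singleton[of \<epsilon>] by eventually_elim (rule *)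
  qed
  also have "\<dots> = ennreal (volume * ln t - volume * ln \<epsilon>)"
    using assms volume_pos
    by (intro nn_integral_FTC_Icc) (auto intro!: derivative_eq_intros)
  also have "volume * ln t - volume * ln \<epsilon> = volume * ln (t / \<epsilon>)"
    using assms by (simp add: ln_div algebra_simps)
  finally show ?thesis .
qed

lemma emeasure_cone_le:
  assumes "0 < \<epsilon>" "\<epsilon> \<le> t" "t \<le> 1" "0 \<le> \<delta>"
  shows "emeasure fractal_measure (cone z \<delta> \<epsilon> t) \<le> ennreal (volume * ln (t / \<epsilon>))"
proof -
  have "cone z \<delta> \<epsilon> t \<subseteq> cone z 0 \<epsilon> t" using assms by (auto simp: cone_def)
  then show ?thesis
    unfolding emeasure_cone[OF assms(1-3), symmetric, of z]
    using assms by (intro emeasure_mono cone_sets) auto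
qed

text \<open>By Bernoulli's inequality the section at radius \<open>r\<close>, of volume \<open>volume * (r - \<delta>) ^ d\<close>, has
  volume at least \<open>volume * r ^ d * (1 - d * \<delta> / r)\<close>.\<close>

lemma emeasure_cone_ge:
  fixes \<delta> \<epsilon> :: real
  assumes "0 < \<epsilon>" "\<epsilon> \<le> 1" "0 \<le> \<delta>" "real CARD('n) * \<delta> \<le> \<epsilon>"
  shows "ennreal (volume * (ln (1 / \<epsilon>) - CARD('n) * \<delta> / \<epsilon>)) \<le> emeasure fractal_measure (cone z \<delta> \<epsilon> 1)"
proof -
  let ?d = "CARD('n)"
  \<comment> \<open>At the upper endpoint the antiderivative has the nonnegative extra term
    \<open>volume * ?d * \<delta>\<close>, which the lower bound drops.\<close>
  have "ennreal (volume * (ln (1 / \<epsilon>) - ?d * \<delta> / \<epsilon>)) \<le>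
      ennreal ((volume * ln 1 + volume * ?d * \<delta> / 1) - (volume * ln \<epsilon> + volume * ?d * \<delta> / \<epsilon>))"
    using assms volume_pos by (intro ennreal_leI) (simp add: ln_div algebra_simps)
  also have "\<dots> = (\<integral>\<^sup>+r. ennreal (volume * (1 / r - ?d * \<delta> / r\<^sup>2)) * indicator {\<epsilon>..1} r \<partial>lborel)"
  proof -
    have D: "((\<lambda>r. volume * ln r + volume * ?d * \<delta> / r) has_real_derivative volume * (1 / x - ?d * \<delta> / x\<^sup>2)) (at x)"
      if "x \<in> {\<epsilon>..1}" for x
      using assms that by (auto intro!: derivative_eq_intros simp: field_simps power2_eq_square)
    have N: "0 \<le> volume * (1 / x - ?d * \<delta> / x\<^sup>2)" if "x \<in> {\<epsilon>..1}" for x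
    proof -
      have "1 / x - ?d * \<delta> / x\<^sup>2 = (x - ?d * \<delta>) / x\<^sup>2"
        using that assms by (simp add: field_simps power2_eq_square)
      then show ?thesis
        using that assms volume_pos by simp
    qed
    show ?thesis
      by (rule nn_integral_FTC_Icc[OF _ D N, symmetric]) (use assms in auto)
  qed
  also have "\<dots> \<le> (\<integral>\<^sup>+r. ennreal (r powr (- real ?d - 1)) * emeasure lborel {x. (x, r) \<in> cone z \<delta> \<epsilon> 1} * indicator {0<..1} r \<partial>lborel)"
  proof (rule nn_integral_mono_AE)
    have *: "ennreal (volume * (1 / r - ?d * \<delta> / r\<^sup>2)) * indicator {\<epsilon>..1} r \<le>
      ennreal (r powr (- real ?d - 1)) * emeasure lborel {x. (x, r) \<in> cone z \<delta> \<epsilon> 1} * indicator {0<..1} r"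
      if "r \<noteq> \<epsilon>" for r
    proof (cases "\<epsilon> < r \<and> r \<le> 1")
      case True
      then have r: "0 < r" "r \<le> 1" using assms by auto
      \<comment> \<open>The dimension is at least \<open>1\<close>, so the bound on
        \<open>?d * \<delta>\<close> also bounds \<open>\<delta>\<close> by \<open>r\<close>, as
        Bernoulli's inequality requires.\<close>
      have "1 * \<delta> \<le> ?d * \<delta>" using assms by (intro mult_right_mono) (auto simp: Suc_le_eq)
      then have \<delta>: "\<delta> \<le> r" using True assms by linarith
      have "{x. (x, r) \<in> cone z \<delta> \<epsilon> 1} = {x. \<nu> (x - z) < r - \<delta>}" using True by (auto simp: cone_def)
      then have e: "emeasure lborel {x. (x, r) \<in> cone z \<delta> \<epsilon> 1} = ennreal ((r - \<delta>) ^ ?d * volume)"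
        using \<delta> by (simp add: emeasure_nu_ball)
      have "1 + ?d * (- \<delta> / r) \<le> (1 + (- \<delta> / r)) ^ ?d"
        using \<delta> r by (intro Bernoulli_inequality) (simp add: field_simps)
      then have "volume * (1 / r) * (1 + ?d * (- \<delta> / r)) \<le> volume * (1 / r) * (1 + (- \<delta> / r)) ^ ?d"
        using r volume_pos by (intro mult_left_mono) auto
      also have "1 + (- \<delta> / r) = (r - \<delta>) / r" using r by (simp add: field_simps)
      also have "volume * (1 / r) * ((r - \<delta>) / r) ^ ?d = r powr (- real ?d - 1) * ((r - \<delta>) ^ ?d * volume)"
        using r by (simp add: powr_diff powr_minus powr_realpow field_simps)
      also have "volume * (1 / r) * (1 + ?d * (- \<delta> / r)) = volume * (1 / r - ?d * \<delta> / r\<^sup>2)"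
        using r by (simp add: field_simps power2_eq_square)
      finally show ?thesis using True r e by (simp add: ennreal_mult'[symmetric] ennreal_leI)
    next
      case False
      then show ?thesis using that by (auto simp: indicator_def)
    qed
    show "AE r in lborel. ennreal (volume * (1 / r - ?d * \<delta> / r\<^sup>2)) * indicator {\<epsilon>..1} r \<le>
      ennreal (r powr (- real ?d - 1)) * emeasure lborel {x. (x, r) \<in> cone z \<delta> \<epsilon> 1} * indicator {0<..1} r"
      using AE_lborel_singleton[of \<epsilon>] by eventually_elim (rule *)
  qed
  also have "\<dots> = emeasure fractal_measure (cone z \<delta> \<epsilon> 1)"
    using assms by (intro emeasure_fractal_measure[symmetric] cone_sets) auto
  finally show ?thesis .
qed

end

section \<open>Coverage and void probabilities of cones\<close>

locale fractal_model = general_norm \<nu> a b + poisson_process M \<Phi> "scale_measure (ennreal l) fractal_measure"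
  for \<nu> :: "real ^ 'n \<Rightarrow> real" and a b l :: real and M :: "'w measure"
    and \<Phi> :: "'w \<Rightarrow> ((real ^ 'n) \<times> real) set" +
  assumes intensity_pos: "0 < l"
begin

section \<open>Coverage of compact sets as an event\<close>

definition covered :: "'w \<Rightarrow> (real ^ 'n) set" where
  "covered \<omega> = (\<Union>(x, r)\<in>\<Phi> \<omega>. {y. \<nu> (y - x) < r})"

lemma radius_bounds: "\<omega> \<in> space M \<Longrightarrow> (x, r) \<in> \<Phi> \<omega> \<Longrightarrow> 0 < r \<and> r \<le> 1"
  using points_in_space[of \<omega>] by (auto simp: space_scale_measure space_fractal_measure)

text \<open>By compactness finitely many balls suffice, and each can be replaced by a smaller one
  with rational radius and centre in \<open>D\<close> that a ball of the process still contains.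
  With \<open>D\<close> countable, coverage becomes a countable combination of void events and hence
  measurable.\<close>

lemma compact_covered_iff:
  assumes \<omega>: "\<omega> \<in> space M" and K: "compact K"
    and D: "\<And>X. open X \<Longrightarrow> X \<noteq> {} \<Longrightarrow> \<exists>d\<in>D. d \<in> X"
  shows "K \<subseteq> covered \<omega> \<longleftrightarrow>
    (\<exists>F. finite F \<and> F \<subseteq> D \<times> (\<rat> \<inter> {0<..}) \<and> K \<subseteq> (\<Union>(q, s)\<in>F. {y. \<nu> (y - q) < s}) \<and>
      (\<forall>(q, s)\<in>F. \<Phi> \<omega> \<inter> cone q s 0 1 \<noteq> {}))"
proof
  assume cov: "K \<subseteq> covered \<omega>"
  define G where "G = {(q, s). q \<in> D \<and> s \<in> \<rat> \<and> 0 < s \<and> \<Phi> \<omega> \<inter> cone q s 0 1 \<noteq> {}}"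
  have "K \<subseteq> (\<Union>p\<in>G. {y. \<nu> (y - fst p) < snd p})"
  proof
    fix y assume "y \<in> K"
    then obtain x r where xr: "(x, r) \<in> \<Phi> \<omega>" "\<nu> (y - x) < r"
      using cov by (auto simp: covered_def)
    \<comment> \<open>Half of the slack \<open>r - \<nu> (y - x)\<close> pays for moving the centre
      from \<open>y\<close> to \<open>q\<close>, the other half for the radius \<open>s\<close>
      around \<open>q\<close>.\<close>
    obtain s where s: "s \<in> \<rat>" "0 < s" "s < (r - \<nu> (y - x)) / 2"
      using Rats_dense_in_real[of 0 "(r - \<nu> (y - x)) / 2"] xr by auto
    have "open {q. \<nu> (q - y) < s}" "{q. \<nu> (q - y) < s} \<noteq> {}"
      using open_nu_ball s zero by (force, metis (mono_tags) diff_self empty_iff mem_Collect_eq)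
    then obtain q where q: "q \<in> D" "\<nu> (q - y) < s" using D[of "{q. \<nu> (q - y) < s}"] by blast
    have "\<nu> (q - x) + s < r"
      using triangle_diff[of q x y] q s by (simp add: field_simps)
    then have "(x, r) \<in> cone q s 0 1"
      using radius_bounds[OF \<omega> xr(1)] by (simp add: cone_def commute)
    then have "(q, s) \<in> G" using xr q s by (auto simp: G_def)
    then show "y \<in> (\<Union>p\<in>G. {y. \<nu> (y - fst p) < snd p})" using q(2)
      by (intro UN_I[of "(q, s)"]) (simp_all add: commute)
  qed
  then obtain F where F: "F \<subseteq> G" "finite F" "K \<subseteq> (\<Union>p\<in>F. {y. \<nu> (y - fst p) < snd p})"
    by (rule compactE_image[OF K open_nu_ball])
  show "\<exists>F. finite F \<and> F \<subseteq> D \<times> (\<rat> \<inter> {0<..}) \<and> K \<subseteq> (\<Union>(q, s)\<in>F. {y. \<nu> (y - q) < s}) \<and>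
      (\<forall>(q, s)\<in>F. \<Phi> \<omega> \<inter> cone q s 0 1 \<noteq> {})"
  proof (intro exI[of _ F] conjI)
    show "F \<subseteq> D \<times> (\<rat> \<inter> {0<..})" "\<forall>(q, s)\<in>F. \<Phi> \<omega> \<inter> cone q s 0 1 \<noteq> {}"
      using F(1) unfolding G_def by blast+
    show "K \<subseteq> (\<Union>(q, s)\<in>F. {y. \<nu> (y - q) < s})"
      using F(3) by (simp add: case_prod_unfold)
  qed (fact F(2))
next
  assume "\<exists>F. finite F \<and> F \<subseteq> D \<times> (\<rat> \<inter> {0<..}) \<and> K \<subseteq> (\<Union>(q, s)\<in>F. {y. \<nu> (y - q) < s}) \<and>
      (\<forall>(q, s)\<in>F. \<Phi> \<omega> \<inter> cone q s 0 1 \<noteq> {})"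
  then obtain F where F: "K \<subseteq> (\<Union>(q, s)\<in>F. {y. \<nu> (y - q) < s})" "\<forall>(q, s)\<in>F. \<Phi> \<omega> \<inter> cone q s 0 1 \<noteq> {}"
    by blast
  show "K \<subseteq> covered \<omega>"
  proof
    fix y assume "y \<in> K"
    then obtain q s where qs: "(q, s) \<in> F" "\<nu> (y - q) < s" using F(1) by blast
    then have "\<Phi> \<omega> \<inter> cone q s 0 1 \<noteq> {}" using F(2) by blast
    then obtain x r where "(x, r) \<in> \<Phi> \<omega>" "\<nu> (x - q) + s < r"
      unfolding cone_def by blast
    with qs have "(x, r) \<in> \<Phi> \<omega> \<and> \<nu> (y - x) < r"
      using triangle_diff[of y x q] commute[of q x] by simp
    then show "y \<in> covered \<omega>" by (auto simp: covered_def)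
  qed
qed

lemma measurable_compact_covered:
  assumes "compact K"
  shows "{\<omega> \<in> space M. K \<subseteq> covered \<omega>} \<in> events"
proof -
  obtain D :: "(real^'n) set" where D: "countable D" "\<And>X. open X \<Longrightarrow> X \<noteq> {} \<Longrightarrow> \<exists>d\<in>D. d \<in> X"
    by (rule countable_dense_setE) blast
  define \<F> where "\<F> = {F. F \<subseteq> D \<times> (\<rat> \<inter> {0<..}) \<and> finite F \<and> K \<subseteq> (\<Union>(q, s)\<in>F. {y. \<nu> (y - q) < s})}"
  have "countable {F. F \<subseteq> D \<times> (\<rat> \<inter> {0<..}) \<and> finite F}"
    using D(1) countable_rat by (subst conj_commute) (intro countable_Collect_finite_subset countable_SIGMA countable_Int1)
  then have cF: "countable \<F>" by (rule countable_subset[rotated]) (auto simp: \<F>_def)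
  have "K \<subseteq> covered \<omega> \<longleftrightarrow> (\<exists>F\<in>\<F>. \<forall>p\<in>F. \<not> \<omega> \<in> void (cone (fst p) (snd p) 0 1))"
    if "\<omega> \<in> space M" for \<omega>
    using compact_covered_iff[OF that assms D(2)] that
    by (simp add: \<F>_def void_def case_prod_unfold conj_commute conj_left_commute Bex_def)
  then have "{\<omega> \<in> space M. K \<subseteq> covered \<omega>} =
    (\<Union>F\<in>\<F>. {\<omega> \<in> space M. \<forall>p\<in>F. \<not> \<omega> \<in> void (cone (fst p) (snd p) 0 1)})"
    by blast
  also have "\<dots> \<in> events"
  proof (rule sets.countable_UN''[OF cF])
    fix F assume "F \<in> \<F>"
    then have fin: "finite F" by (simp add: \<F>_def)
    show "{\<omega> \<in> space M. \<forall>p\<in>F. \<not> \<omega> \<in> void (cone (fst p) (snd p) 0 1)} \<in> events"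
    proof (rule sets.sets_Collect_finite_All[OF _ fin])
      fix p assume "p \<in> F"
      have "void (cone (fst p) (snd p) 0 1) \<in> events"
        by (intro void_sets) (simp add: cone_sets)
      then show "{\<omega> \<in> space M. \<not> \<omega> \<in> void (cone (fst p) (snd p) 0 1)} \<in> events"
        by measurable
    qed
  qed
  finally show ?thesis .
qed

lemma measurable_covered: "{\<omega> \<in> space M. covered \<omega> = UNIV} \<in> events"
proof -
  have "(covered \<omega> = UNIV) = (\<forall>m::nat. cball 0 (real m) \<subseteq> covered \<omega>)" for \<omega>
  proof
    assume "\<forall>m::nat. cball 0 (real m) \<subseteq> covered \<omega>"
    moreover have "y \<in> cball 0 (real (nat \<lceil>norm y\<rceil>))" for y :: "real^'n" by (simp add: of_nat_ceiling)
    ultimately show "covered \<omega> = UNIV" by blast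
  qed auto
  then show ?thesis
    by (auto intro!: sets.sets_Collect_countable_All measurable_compact_covered)
qed

lemma cone_sets_scaled [simp]:
  "0 \<le> \<epsilon> \<Longrightarrow> t \<le> 1 \<Longrightarrow> cone z \<delta> \<epsilon> t \<in> sets (scale_measure (ennreal l) fractal_measure)"
  by (simp add: cone_sets)

text \<open>A given point is missed by all balls of radius above \<open>\<epsilon>\<close> with
  probability \<open>\<epsilon> powr exponent\<close>. The critical case is that this exponent
  equals the dimension.\<close>

definition exponent :: real where
  "exponent = l * volume"

lemma exponent_pos: "0 < exponent"
  using intensity_pos volume_pos by (simp add: exponent_def)

section \<open>Void probabilities of one and of two cones\<close>

lemma emeasure_scaled_cone:
  assumes "0 < \<epsilon>" "\<epsilon> \<le> t" "t \<le> 1"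
  shows "emeasure (scale_measure (ennreal l) fractal_measure) (cone z 0 \<epsilon> t) = ennreal (exponent * ln (t / \<epsilon>))"
  using assms intensity_pos volume_pos
  by (simp add: emeasure_cone ennreal_mult'[symmetric] exponent_def mult.assoc)

lemma finite_cone:
  assumes "0 < \<epsilon>" "t \<le> 1" "0 \<le> \<delta>"
  shows "emeasure (scale_measure (ennreal l) fractal_measure) (cone z \<delta> \<epsilon> t) < \<infinity>"
proof (cases "\<epsilon> \<le> t")
  case True
  then show ?thesis
    using emeasure_cone_le[OF assms(1) True assms(2,3), of z]
    by (auto simp: ennreal_mult_less_top intro: le_less_trans)
next
  case False
  then have "cone z \<delta> \<epsilon> t = {}" by (auto simp: cone_def)
  then show ?thesis by simp
qed

lemma prob_void_cone:
  assumes "0 < \<epsilon>" "\<epsilon> \<le> t" "t \<le> 1"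
  shows "prob (void (cone z 0 \<epsilon> t)) = (\<epsilon> / t) powr exponent"
proof -
  have "0 \<le> exponent * ln (t / \<epsilon>)"
    using assms exponent_pos by (intro mult_nonneg_nonneg) auto
  then have "prob (void (cone z 0 \<epsilon> t)) = exp (- (exponent * ln (t / \<epsilon>)))"
    using assms by (subst prob_void) (auto intro!: finite_cone[simplified] simp: measure_def emeasure_scaled_cone simp del: emeasure_scale_measure)
  then show ?thesis using assms by (simp add: powr_def ln_div algebra_simps)
qed

text \<open>Asking the ball to contain a whole neighbourhood of \<open>z\<close> costs only the
  exponential factor, which stays bounded when \<open>\<delta>\<close> is of the order of
  \<open>\<epsilon>\<close>.\<close>

lemma prob_void_cone_le:
  assumes "0 < \<epsilon>" "\<epsilon> \<le> 1" "0 \<le> \<delta>" "real CARD('n) * \<delta> \<le> \<epsilon>"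
  shows "prob (void (cone z \<delta> \<epsilon> 1)) \<le> \<epsilon> powr exponent * exp (exponent * real CARD('n) * \<delta> / \<epsilon>)"
proof -
  let ?S = "scale_measure (ennreal l) fractal_measure :: ((real^'n) \<times> real) measure"
  have fin: "emeasure ?S (cone z \<delta> \<epsilon> 1) < \<infinity>"
    using assms by (intro finite_cone) auto
  have "ennreal (exponent * (ln (1 / \<epsilon>) - real CARD('n) * \<delta> / \<epsilon>)) =
     ennreal l * ennreal (volume * (ln (1 / \<epsilon>) - real CARD('n) * \<delta> / \<epsilon>))"
    using intensity_pos by (simp add: exponent_def ennreal_mult'[symmetric] mult.assoc)
  also have "\<dots> \<le> emeasure ?S (cone z \<delta> \<epsilon> 1)"
    using emeasure_cone_ge[OF assms, of z] by (simp add: mult_left_mono)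
  also have "\<dots> = ennreal (measure ?S (cone z \<delta> \<epsilon> 1))"
    using fin by (intro emeasure_eq_ennreal_measure) (simp add: less_top)
  finally have *: "exponent * (ln (1 / \<epsilon>) - real CARD('n) * \<delta> / \<epsilon>) \<le> measure ?S (cone z \<delta> \<epsilon> 1)"
    by (simp add: ennreal_le_iff)
  have "prob (void (cone z \<delta> \<epsilon> 1)) = exp (- measure ?S (cone z \<delta> \<epsilon> 1))"
    using fin assms by (intro prob_void) auto
  also have "\<dots> \<le> exp (- (exponent * (ln (1 / \<epsilon>) - real CARD('n) * \<delta> / \<epsilon>)))"
    using * by simp
  also have "\<dots> = \<epsilon> powr exponent * exp (exponent * real CARD('n) * \<delta> / \<epsilon>)"
    using assms by (simp add: powr_def ln_div exp_add[symmetric] algebra_simps)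
  finally show ?thesis .
qed

text \<open>A ball of radius at most \<open>t\<close> cannot contain both \<open>x\<close> and
  \<open>y\<close>. Hence the balls around \<open>y\<close> of such radius are independent of all
  balls around \<open>x\<close>, and correlation comes only from radii above
  \<open>t\<close>.\<close>

lemma prob_void_two_cones_le:
  assumes "0 < \<epsilon>" "\<epsilon> \<le> 1" "0 < t" "t \<le> 1" "2 * t \<le> \<nu> (x - y)"
  shows "prob (void (cone x 0 \<epsilon> 1) \<inter> void (cone y 0 \<epsilon> 1)) \<le> \<epsilon> powr (2 * exponent) * t powr (- exponent)"
proof (cases "\<epsilon> \<le> t")
  case True
  have disj: "cone x 0 \<epsilon> 1 \<inter> cone y 0 \<epsilon> t = {}"
  proof (rule ccontr)
    assume "cone x 0 \<epsilon> 1 \<inter> cone y 0 \<epsilon> t \<noteq> {}"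
    then obtain w r where "\<nu> (w - x) < r" "\<nu> (w - y) < r" "r \<le> t" by (auto simp: cone_def)
    then show False using triangle_diff[of x y w] commute[of x w] assms(5) by simp
  qed
  have "cone y 0 \<epsilon> t \<subseteq> cone y 0 \<epsilon> 1" using assms by (auto simp: cone_def)
  then have "prob (void (cone x 0 \<epsilon> 1) \<inter> void (cone y 0 \<epsilon> 1)) \<le> prob (void (cone x 0 \<epsilon> 1) \<inter> void (cone y 0 \<epsilon> t))"
    using assms by (intro finite_measure_mono sets.Int void_sets Int_mono void_antimono) auto
  also have "\<dots> = (\<epsilon> / 1) powr exponent * (\<epsilon> / t) powr exponent"
    using assms True disj by (subst prob_void_Int) (auto simp: prob_void_cone intro!: finite_cone[simplified])
  also have "\<dots> = \<epsilon> powr (2 * exponent) * t powr (- exponent)"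
    using assms by (simp add: powr_divide powr_minus powr_add[symmetric] field_simps flip: mult_2)
  finally show ?thesis .
next
  case False
  \<comment> \<open>If \<open>t\<close> is below \<open>\<epsilon>\<close>, a single void
    probability is already small enough, because \<open>(\<epsilon> / t) powr exponent\<close> is at
    least \<open>1\<close>.\<close>
  have "prob (void (cone x 0 \<epsilon> 1) \<inter> void (cone y 0 \<epsilon> 1)) \<le> prob (void (cone x 0 \<epsilon> 1))"
    using assms by (intro finite_measure_mono void_sets) auto
  also have "\<dots> = \<epsilon> powr exponent * 1" using assms by (simp add: prob_void_cone)
  also have "\<dots> \<le> \<epsilon> powr exponent * (\<epsilon> / t) powr exponent"
    using assms False exponent_pos by (intro mult_left_mono ge_one_powr_ge_zero) auto
  also have "\<dots> = \<epsilon> powr (2 * exponent) * t powr (- exponent)"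
    using assms by (simp add: powr_divide powr_minus powr_add[symmetric] field_simps flip: mult_2)
  finally show ?thesis .
qed

end

section \<open>Dyadic grids\<close>

definition grid :: "nat \<Rightarrow> ('n::finite \<Rightarrow> nat) set" where
  "grid n = {k. \<forall>i. k i < 2 ^ n}"

definition grid_point :: "real ^ 'n \<Rightarrow> nat \<Rightarrow> ('n \<Rightarrow> nat) \<Rightarrow> real ^ 'n" where
  "grid_point u n k = (\<chi> i. u $ i + real (k i) / 2 ^ n)"

lemma grid_eq_PiE: "grid n = (PiE UNIV (\<lambda>_. {..<2 ^ n}) :: ('n::finite \<Rightarrow> nat) set)"
  by (auto simp: grid_def PiE_iff)

lemma finite_grid [simp]: "finite (grid n)"
  unfolding grid_eq_PiE by (intro finite_PiE) auto

lemma card_grid: "card (grid n :: ('n::finite \<Rightarrow> nat) set) = (2 ^ n) ^ CARD('n)"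
  unfolding grid_eq_PiE by (subst card_PiE) auto

lemma infnorm_leI:
  fixes x :: "real ^ 'n"
  assumes "\<And>i. \<bar>x $ i\<bar> \<le> t"
  shows "infnorm x \<le> t"
  unfolding infnorm_cart by (rule cSup_least) (use assms in auto)

context general_norm
begin

lemma nu_le:
  assumes "\<And>i. \<bar>x $ i\<bar> \<le> t"
  shows "\<nu> x \<le> b * t"
proof -
  have "b * infnorm x \<le> b * t"
    using infnorm_leI[OF assms] constants_pos(2) by (intro mult_left_mono) auto
  with le_infnorm[of x] show ?thesis by linarith
qed

text \<open>A cube of side \<open>2 ^ -n\<close> has \<open>\<nu>\<close>-diameter at most \<open>b / 2 ^ n\<close>. The factor \<open>CARD('n)\<close> makes
  \<open>emeasure_cone_ge\<close> applicable; the factor \<open>4\<close> ensures that a ball centred in the cube with radius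
  above \<open>top_radius n / 2\<close> contains it with room to spare.\<close>

definition top_radius :: "nat \<Rightarrow> real" where
  "top_radius n = 4 * b * CARD('n) / 2 ^ n"

lemma top_radius_pos: "0 < top_radius n"
  using constants_pos by (simp add: top_radius_def)

lemma top_radius_Suc: "top_radius (Suc n) = top_radius n / 2"
  by (simp add: top_radius_def)

lemma top_radius_ge: "4 * b / 2 ^ n \<le> top_radius n"
proof -
  have "4 * b * 1 \<le> 4 * b * real CARD('n)"
    using constants_pos by (intro mult_left_mono) (auto simp: Suc_le_eq)
  then show ?thesis by (simp add: top_radius_def divide_right_mono)
qed

lemma eventually_top_radius_le_1: "\<forall>\<^sub>F n in sequentially. top_radius n \<le> 1"
proof -
  have "(\<lambda>n. 4 * b * CARD('n) * (1 / 2) ^ n) \<longlonglongrightarrow> 4 * b * CARD('n) * 0"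
    by (intro tendsto_intros LIMSEQ_power_zero) auto
  moreover have "top_radius = (\<lambda>n. 4 * b * CARD('n) * (1 / 2) ^ n)"
    by (simp add: fun_eq_iff top_radius_def power_divide)
  ultimately have "top_radius \<longlonglongrightarrow> 0" by simp
  then have "\<forall>\<^sub>F n in sequentially. top_radius n < 1" by (rule order_tendstoD) auto
  then show ?thesis by eventually_elim simp
qed

text \<open>A point of \<open>big_cone u n k\<close> gives a ball that contains the dyadic cube with lower corner
  \<open>grid_point u n k\<close>.\<close>

definition big_cone :: "real ^ 'n \<Rightarrow> nat \<Rightarrow> ('n \<Rightarrow> nat) \<Rightarrow> ((real ^ 'n) \<times> real) set" where
  "big_cone u n k = cone (grid_point u n k) (b / 2 ^ n) (top_radius n) 1"

text \<open>The centre lies in the open cube, and the radius in the layer between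
  \<open>top_radius (Suc n)\<close> and \<open>top_radius n\<close>. This layer is the one that
  \<open>big_cone\<close> gains in passing to the next level.\<close>

definition hit_region :: "real ^ 'n \<Rightarrow> nat \<Rightarrow> ('n \<Rightarrow> nat) \<Rightarrow> ((real ^ 'n) \<times> real) set" where
  "hit_region u n k = box (grid_point u n k) (grid_point u n k + (1 / 2 ^ n) *\<^sub>R One) \<times> {top_radius n / 2 <.. top_radius n}"

lemma mem_hit_region:
  "(x, r) \<in> hit_region u n k \<longleftrightarrow>
    (\<forall>i. grid_point u n k $ i < x $ i \<and> x $ i < grid_point u n k $ i + 1 / 2 ^ n) \<and>
    top_radius n / 2 < r \<and> r \<le> top_radius n"
proof -
  have "(One :: real^'n) $ i = 1" for i
    by (simp add: cart_eq_inner_axis axis_in_Basis_iff)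
  then show ?thesis by (simp add: hit_region_def mem_box_cart)
qed

lemma disjoint_hit_regions: "disjoint_family_on (hit_region u n) A"
proof (unfold disjoint_family_on_def, intro ballI impI)
  fix k j :: "'n \<Rightarrow> nat" assume "k \<noteq> j"
  then obtain i where i: "k i \<noteq> j i" by auto
  show "hit_region u n k \<inter> hit_region u n j = {}"
  proof (rule ccontr)
    assume "hit_region u n k \<inter> hit_region u n j \<noteq> {}"
    then obtain x r where "(x, r) \<in> hit_region u n k" "(x, r) \<in> hit_region u n j" by auto
    then have "real (k i) / 2 ^ n < real (j i) / 2 ^ n + 1 / 2 ^ n"
      "real (j i) / 2 ^ n < real (k i) / 2 ^ n + 1 / 2 ^ n"
      unfolding mem_hit_region grid_point_def by (auto dest!: spec[of _ i])
    then have "real (k i) < real (j i) + 1" "real (j i) < real (k i) + 1"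
      by (simp_all add: field_simps)
    then show False using i by linarith
  qed
qed

text \<open>The index \<open>k i div 2\<close> is that of the parent cube. Passing from its corner
  to the corner of the child costs at most \<open>b / 2 ^ Suc n\<close>, exactly what halving the
  margin \<open>b / 2 ^ n\<close> releases.\<close>

lemma big_cone_mono:
  "big_cone u n (\<lambda>i. k i div 2) \<subseteq> big_cone u (Suc n) k"
proof
  fix p assume p: "p \<in> big_cone u n (\<lambda>i. k i div 2)"
  obtain x r where [simp]: "p = (x, r)" by (cases p)
  let ?p = "grid_point u n (\<lambda>i. k i div 2)" and ?q = "grid_point u (Suc n) k"
  define B where "B = b / 2 ^ n"
  have B: "b * (1 / 2 ^ Suc n) = B / 2" "b / 2 ^ Suc n = B / 2" by (simp_all add: B_def)
  have 1: "\<nu> (?p - ?q) \<le> b * (1 / 2 ^ Suc n)"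
  proof (rule nu_le)
    fix i
    have "real (k i) = 2 * real (k i div 2) + real (k i mod 2)"
      by (metis mult_div_mod_eq of_nat_add of_nat_mult of_nat_numeral)
    then have "(?p - ?q) $ i = - real (k i mod 2) / 2 ^ Suc n"
      by (simp add: grid_point_def field_simps)
    moreover have "k i mod 2 \<le> 1" by simp
    ultimately show "\<bar>(?p - ?q) $ i\<bar> \<le> 1 / 2 ^ Suc n"
      by (simp add: divide_right_mono)
  qed
  have 2: "\<nu> (x - ?p) + B < r" "top_radius n < r" "r \<le> 1"
    using p by (auto simp: big_cone_def cone_def B_def)
  have "\<nu> (x - ?q) + b / 2 ^ Suc n < r"
    using 1 2(1) triangle_diff[of x ?q ?p] unfolding B by linarith
  moreover have "top_radius n / 2 < r"
    using 2(2) top_radius_pos[of n] by linarith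
  ultimately show "p \<in> big_cone u (Suc n) k"
    using 2(3) by (simp add: big_cone_def cone_def top_radius_Suc)
qed

text \<open>The centre and the corner of the child lie in the same parent cube, within
  \<open>\<nu>\<close>-distance \<open>B = b / 2 ^ n\<close>. With the margin \<open>B / 2\<close>
  of the child this gives \<open>3 * B / 2\<close>, less than
  \<open>2 * B \<le> top_radius n / 2 < r\<close>.\<close>

lemma hit_region_subset_big_cone:
  assumes "top_radius n \<le> 1"
  shows "hit_region u n (\<lambda>i. k i div 2) \<subseteq> big_cone u (Suc n) k"
proof
  fix p assume p: "p \<in> hit_region u n (\<lambda>i. k i div 2)"
  obtain x r where [simp]: "p = (x, r)" by (cases p)
  let ?p = "grid_point u n (\<lambda>i. k i div 2)" and ?q = "grid_point u (Suc n) k"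
  have 1: "\<nu> (x - ?q) \<le> b * (1 / 2 ^ n)"
  proof (rule nu_le)
    fix i
    have "real (k i) = 2 * real (k i div 2) + real (k i mod 2)"
      by (metis mult_div_mod_eq of_nat_add of_nat_mult of_nat_numeral)
    then have "(?q - ?p) $ i = real (k i mod 2) / 2 ^ Suc n"
      by (simp add: grid_point_def field_simps)
    moreover have "k i mod 2 \<le> 1" by simp
    ultimately have "0 \<le> (?q - ?p) $ i" "(?q - ?p) $ i \<le> 1 / 2 ^ Suc n"
      by (simp_all add: divide_right_mono)
    moreover have "1 / 2 ^ Suc n \<le> (1 / 2 ^ n :: real)" by (simp add: field_simps)
    moreover have "?p $ i < x $ i" "x $ i < ?p $ i + 1 / 2 ^ n"
      using p by (auto simp: mem_hit_region)
    ultimately show "\<bar>(x - ?q) $ i\<bar> \<le> 1 / 2 ^ n"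
      by (simp add: abs_le_iff)
  qed
  define B where "B = b / 2 ^ n"
  have B: "b / 2 ^ Suc n = B / 2" "b * (1 / 2 ^ n) = B" by (simp_all add: B_def)
  have 2: "top_radius n / 2 < r" "r \<le> top_radius n"
    using p by (auto simp: mem_hit_region)
  have "4 * B \<le> top_radius n" "0 < B"
    using top_radius_ge[of n] constants_pos by (simp_all add: B_def)
  then have "\<nu> (x - ?q) + b / 2 ^ Suc n < r"
    using 1 2(1) unfolding B by linarith
  then show "p \<in> big_cone u (Suc n) k"
    using 2 assms by (simp add: big_cone_def cone_def top_radius_Suc)
qed

lemma grid_cell:
  assumes "\<And>i. u $ i \<le> y $ i" "\<And>i. y $ i < u $ i + 1"
  obtains k where "k \<in> grid n" "\<And>i. \<bar>(y - grid_point u n k) $ i\<bar> \<le> 1 / 2 ^ n"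
proof
  define k where "k = (\<lambda>i. nat \<lfloor>2 ^ n * (y $ i - u $ i)\<rfloor>)"
  have *: "real (k i) \<le> 2 ^ n * (y $ i - u $ i)" "2 ^ n * (y $ i - u $ i) < real (k i) + 1" for i
  proof -
    have "0 \<le> 2 ^ n * (y $ i - u $ i)" using assms(1)[of i] by simp
    then show "real (k i) \<le> 2 ^ n * (y $ i - u $ i)" "2 ^ n * (y $ i - u $ i) < real (k i) + 1"
      unfolding k_def by (simp_all add: of_nat_nat)
  qed
  show "k \<in> grid n"
    unfolding grid_def
  proof safe
    fix i
    have "2 ^ n * (y $ i - u $ i) < 2 ^ n * 1"
      using assms(2)[of i] by (intro mult_strict_left_mono) auto
    then have "real (k i) < real (2 ^ n)" using *(1)[of i] by (simp only: of_nat_power of_nat_numeral mult_1_right)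
    then show "k i < 2 ^ n" by (simp only: of_nat_less_iff)
  qed
  show "\<bar>(y - grid_point u n k) $ i\<bar> \<le> 1 / 2 ^ n" for i
  proof -
    have "real (k i) / 2 ^ n \<le> y $ i - u $ i" "y $ i - u $ i < real (k i) / 2 ^ n + 1 / 2 ^ n"
      using *[of i] by (simp_all add: field_simps)
    then show ?thesis by (simp add: grid_point_def abs_le_iff)
  qed
qed

lemma hit_region_sets:
  assumes "top_radius n \<le> 1"
  shows "hit_region u n k \<in> sets fractal_measure"
proof -
  have "hit_region u n k = {p \<in> space fractal_measure.
     fst p \<in> box (grid_point u n k) (grid_point u n k + (1 / 2 ^ n) *\<^sub>R One) \<and> top_radius n / 2 < snd p \<and> snd p \<le> top_radius n}"
    using assms top_radius_pos[of n] by (auto simp: hit_region_def space_fractal_measure)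
  also have "\<dots> \<in> sets fractal_measure" by measurable
  finally show ?thesis .
qed

lemma emeasure_grid_box:
  "emeasure lborel (box z (z + (1 / 2 ^ n) *\<^sub>R (One :: real ^ 'n))) = ennreal ((1 / 2 ^ n) ^ CARD('n))"
  by (subst emeasure_lborel_box) (auto simp: inner_add_left)

text \<open>The density at radii of order \<open>2 ^ -n\<close> compensates the volume of the cube
  and the length of the layer, so the lower bound does not depend on \<open>n\<close>. As the
  density decreases in the radius, its values at the two ends of the layer bound it from below and
  above.\<close>

lemma emeasure_hit_region:
  assumes t: "top_radius n \<le> 1"
  shows "ennreal ((4 * b * CARD('n)) powr (- CARD('n)) / 2) \<le> emeasure fractal_measure (hit_region u n k)"
    and "emeasure fractal_measure (hit_region u n k) < \<infinity>"
proof -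
  let ?d = "CARD('n)" and ?t = "top_radius n"
  let ?f = "\<lambda>r. ennreal (r powr (- real ?d - 1)) * emeasure lborel {x. (x, r) \<in> hit_region u n k} * indicator {0<..1} r"
  have e: "emeasure fractal_measure (hit_region u n k) = (\<integral>\<^sup>+r. ?f r \<partial>lborel)"
    using assms by (intro emeasure_fractal_measure hit_region_sets)
  have f: "?f r = ennreal (r powr (- real ?d - 1) * (1 / 2 ^ n) ^ ?d) * indicator {?t/2<..?t} r" for r
  proof (cases "r \<in> {?t/2<..?t}")
    case True
    then have "{x. (x, r) \<in> hit_region u n k} = box (grid_point u n k) (grid_point u n k + (1 / 2 ^ n) *\<^sub>R One)"
      by (auto simp: hit_region_def)
    moreover have "0 < r \<and> r \<le> 1" using True t top_radius_pos[of n] by auto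
    ultimately show ?thesis using True by (simp add: emeasure_grid_box ennreal_mult')
  next
    case False
    then have "{x. (x, r) \<in> hit_region u n k} = {}" by (auto simp: hit_region_def)
    then show ?thesis using False by simp
  qed
  have "ennreal ((4 * b * ?d) powr (- ?d) / 2) = ennreal (?t powr (- real ?d - 1) * (1 / 2 ^ n) ^ ?d) * ennreal (?t - ?t / 2)"
  proof -
    have "?t powr (- real ?d - 1) * (1 / 2 ^ n) ^ ?d * (?t - ?t / 2) = (?t * 2 ^ n) powr (- ?d) / 2"
      using top_radius_pos[of n]
      by (simp add: powr_diff powr_minus powr_mult powr_realpow field_simps power_one_over)
    moreover have "?t * 2 ^ n = 4 * b * ?d" by (simp add: top_radius_def)
    ultimately show ?thesis using top_radius_pos[of n] by (simp add: ennreal_mult[symmetric])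
  qed
  also have "\<dots> = (\<integral>\<^sup>+r. ennreal (?t powr (- real ?d - 1) * (1 / 2 ^ n) ^ ?d) * indicator {?t/2<..?t} r \<partial>lborel)"
    using top_radius_pos[of n] by (subst nn_integral_cmult_indicator) auto
  also have "\<dots> \<le> (\<integral>\<^sup>+r. ?f r \<partial>lborel)"
    unfolding f using top_radius_pos[of n]
    by (intro nn_integral_mono) (auto simp: indicator_def intro!: ennreal_leI mult_right_mono powr_mono2')
  finally show "ennreal ((4 * b * ?d) powr (- ?d) / 2) \<le> emeasure fractal_measure (hit_region u n k)"
    unfolding e .
  have "(\<integral>\<^sup>+r. ?f r \<partial>lborel) \<le> (\<integral>\<^sup>+r. ennreal ((?t/2) powr (- real ?d - 1) * (1 / 2 ^ n) ^ ?d) * indicator {?t/2<..?t} r \<partial>lborel)"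
    unfolding f using top_radius_pos[of n]
    by (intro nn_integral_mono) (auto simp: indicator_def intro!: ennreal_leI mult_right_mono powr_mono2')
  also have "\<dots> < \<infinity>"
    using top_radius_pos[of n] by (subst nn_integral_cmult_indicator) (auto simp: ennreal_mult_less_top)
  finally show "emeasure fractal_measure (hit_region u n k) < \<infinity>" unfolding e .
qed

end

section \<open>The critical intensity\<close>

context fractal_model
begin

text \<open>A cube may be alive although it is covered, for instance by several balls jointly. What
  matters is that if no cube is alive, the unit cube at \<open>u\<close> is covered, and that the
  set is determined by void events.\<close>

definition alive :: "real ^ 'n \<Rightarrow> nat \<Rightarrow> 'w \<Rightarrow> ('n \<Rightarrow> nat) set" where
  "alive u n \<omega> = {k \<in> grid n. \<omega> \<in> void (big_cone u n k)}"

lemma big_cone_sets [simp]: "big_cone u n k \<in> sets (scale_measure (ennreal l) fractal_measure)"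
  using top_radius_pos[of n] by (simp add: big_cone_def cone_sets)

lemma finite_big_cone: "emeasure (scale_measure (ennreal l) fractal_measure) (big_cone u n k) < \<infinity>"
  unfolding big_cone_def using top_radius_pos[of n] constants_pos by (intro finite_cone) auto

text \<open>There are finitely many possible sets of alive cubes, and each is prescribed by a finite
  Boolean combination of void events of big cones, whose radii all exceed
  \<open>top_radius n\<close>.\<close>

lemma sets_Collect_alive: "{\<omega> \<in> space M. P (alive u n \<omega>)} \<in> sigma_sets (space M) (void_events (UNIV \<times> {top_radius n <..}))"
proof -
  let ?N = "sigma (space M) (void_events (UNIV \<times> {top_radius n <..}))"
  have sub: "void_events R \<subseteq> Pow (space M)" for R
    using void_subset_space by (auto simp: void_events_def)
  have sN: "sets ?N = sigma_sets (space M) (void_events (UNIV \<times> {top_radius n <..}))"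
    using sub by (simp add: sets_measure_of)
  have spN: "space ?N = space M" using sub by (simp add: space_measure_of)
  have m: "{\<omega> \<in> space ?N. \<omega> \<in> void (big_cone u n k)} \<in> sets ?N" for k
  proof -
    have "void (big_cone u n k) \<in> void_events (UNIV \<times> {top_radius n <..})"
      by (intro void_eventsI finite_big_cone big_cone_sets) (auto simp: big_cone_def cone_def)
    moreover have "{\<omega> \<in> space M. \<omega> \<in> void (big_cone u n k)} = void (big_cone u n k)"
      using void_subset_space by auto
    ultimately show ?thesis unfolding sN spN by auto
  qed
  have eq: "{\<omega> \<in> space ?N. P (alive u n \<omega>)} =
    (\<Union>V\<in>{V. V \<subseteq> grid n \<and> P V}. {\<omega> \<in> space ?N. \<forall>k\<in>grid n. \<omega> \<in> void (big_cone u n k) \<longleftrightarrow> k \<in> V})" (is "_ = ?R")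
  proof (intro equalityI subsetI)
    fix \<omega> assume "\<omega> \<in> {\<omega> \<in> space ?N. P (alive u n \<omega>)}"
    then show "\<omega> \<in> ?R" by (intro UN_I[of "alive u n \<omega>"]) (auto simp: alive_def)
  next
    fix \<omega> assume "\<omega> \<in> ?R"
    then obtain V where V: "V \<subseteq> grid n" "P V" "\<omega> \<in> space ?N"
      "\<forall>k\<in>grid n. \<omega> \<in> void (big_cone u n k) \<longleftrightarrow> k \<in> V" by auto
    then have "alive u n \<omega> = V" by (auto simp: alive_def)
    with V show "\<omega> \<in> {\<omega> \<in> space ?N. P (alive u n \<omega>)}" by simp
  qed
  have "{\<omega> \<in> space ?N. P (alive u n \<omega>)} \<in> sets ?N"
    unfolding eq
  proof (intro sets.finite_UN)
    show "finite {V :: ('n \<Rightarrow> nat) set. V \<subseteq> grid n \<and> P V}"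
      by (rule finite_subset[of _ "Pow (grid n)"]) auto
  next
    fix V
    show "{\<omega> \<in> space ?N. \<forall>k\<in>grid n. \<omega> \<in> void (big_cone u n k) \<longleftrightarrow> k \<in> V} \<in> sets ?N"
    proof (rule sets.sets_Collect_finite_All[OF _ finite_grid])
      fix k :: "'n \<Rightarrow> nat"
      show "{\<omega> \<in> space ?N. \<omega> \<in> void (big_cone u n k) \<longleftrightarrow> k \<in> V} \<in> sets ?N"
        using m[of k] sets.sets_Collect_neg[OF m[of k]] by (cases "k \<in> V") simp_all
    qed
  qed
  then show ?thesis unfolding sN spN .
qed

lemma sets_alive [measurable]: "{\<omega> \<in> space M. P (alive u n \<omega>)} \<in> events"
proof -
  have "sigma_sets (space M) (void_events (UNIV \<times> {top_radius n <..})) \<subseteq> events"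
    by (rule sets.sigma_sets_subset) (auto simp: void_events_def)
  then show ?thesis using sets_Collect_alive by blast
qed

text \<open>A living child has a living parent, and a point in the hit region of the parent yields a
  ball that kills all its children.\<close>

lemma alive_Suc_empty:
  assumes t: "top_radius n \<le> 1" and \<omega>: "\<omega> \<in> space M"
    and hit: "\<And>k. k \<in> alive u n \<omega> \<Longrightarrow> \<omega> \<notin> void (hit_region u n k)"
  shows "alive u (Suc n) \<omega> = {}"
proof (rule ccontr)
  assume "alive u (Suc n) \<omega> \<noteq> {}"
  then obtain k where k: "k \<in> grid (Suc n)" "\<omega> \<in> void (big_cone u (Suc n) k)"
    by (auto simp: alive_def)
  let ?k = "\<lambda>i. k i div 2"
  have "?k \<in> grid n" using k(1) by (auto simp: grid_def less_mult_imp_div_less mult.commute)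
  moreover have "\<omega> \<in> void (big_cone u n ?k)" "\<omega> \<in> void (hit_region u n ?k)"
    using k(2) void_antimono[OF big_cone_mono[of u n k]] void_antimono[OF hit_region_subset_big_cone[OF t, of u k]]
    by auto
  ultimately show False using hit[of ?k] by (simp add: alive_def)
qed

lemma covered_cell:
  assumes \<omega>: "\<omega> \<in> space M" and e: "alive u n \<omega> = {}"
    and y: "\<And>i. u $ i \<le> y $ i" "\<And>i. y $ i < u $ i + 1"
  shows "y \<in> covered \<omega>"
proof -
  obtain k where k: "k \<in> grid n" "\<And>i. \<bar>(y - grid_point u n k) $ i\<bar> \<le> 1 / 2 ^ n"
    using grid_cell[OF y] by blast
  have "\<omega> \<notin> void (big_cone u n k)" using e k(1) by (auto simp: alive_def)
  then obtain x r where xr: "(x, r) \<in> \<Phi> \<omega>" "\<nu> (x - grid_point u n k) + b / 2 ^ n < r"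
    using \<omega> unfolding void_def big_cone_def cone_def by auto
  have "\<nu> (y - grid_point u n k) \<le> b * (1 / 2 ^ n)" by (rule nu_le) (rule k)
  then have "\<nu> (y - x) < r"
    using xr(2) triangle_diff[of y x "grid_point u n k"] commute[of x "grid_point u n k"] by simp
  then show ?thesis using xr(1) by (auto simp: covered_def)
qed

text \<open>The exponent is the lower bound of \<open>emeasure_hit_region\<close> times the
  intensity, so the value is the same for all cubes and levels.\<close>

definition hit_prob :: real where
  "hit_prob = 1 - exp (- (l * ((4 * b * CARD('n)) powr (- CARD('n)) / 2)))"

lemma hit_prob_bounds: "0 < hit_prob" "hit_prob \<le> 1"
  using intensity_pos constants_pos by (auto simp: hit_prob_def)

lemma hit_region_sets_scaled:
  "top_radius n \<le> 1 \<Longrightarrow> hit_region u n k \<in> sets (scale_measure (ennreal l) fractal_measure)"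
  by (simp add: hit_region_sets)

lemma finite_hit_region:
  "top_radius n \<le> 1 \<Longrightarrow> emeasure (scale_measure (ennreal l) fractal_measure) (hit_region u n k) < \<infinity>"
  using emeasure_hit_region(2)[of n u k] by (simp add: ennreal_mult_less_top)

lemma prob_hit:
  assumes t: "top_radius n \<le> 1"
  shows "hit_prob \<le> 1 - prob (void (hit_region u n k))"
proof -
  let ?S = "scale_measure (ennreal l) fractal_measure :: ((real^'n) \<times> real) measure"
  let ?c = "(4 * b * CARD('n)) powr (- CARD('n)) / 2"
  have "ennreal (l * ?c) = ennreal l * ennreal ?c"
    using intensity_pos by (intro ennreal_mult') auto
  also have "\<dots> \<le> emeasure ?S (hit_region u n k)"
    using emeasure_hit_region(1)[OF t, of u k] by (simp add: mult_left_mono)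
  also have "\<dots> = ennreal (measure ?S (hit_region u n k))"
    using finite_hit_region[OF t] by (intro emeasure_eq_ennreal_measure) (auto simp: less_top)
  finally have "l * ?c \<le> measure ?S (hit_region u n k)"
    by (simp add: ennreal_le_iff)
  then show ?thesis
    unfolding hit_prob_def
    by (subst prob_void[OF hit_region_sets_scaled[OF t] finite_hit_region[OF t]]) simp
qed

definition extinct :: "real ^ 'n \<Rightarrow> nat \<Rightarrow> 'w set" where
  "extinct u n = {\<omega> \<in> space M. alive u n \<omega> = {}}"

text \<open>The radii in the hit regions are at most \<open>top_radius n\<close>, those that decide which cubes are alive are
  larger, and the hit regions of distinct cubes are disjoint; so the hits are independent of each
  other and of the set of alive cubes.\<close>

lemma prob_extinct_Suc:
  assumes t: "top_radius n \<le> 1"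
  shows "prob (extinct u n) + hit_prob ^ K * prob {\<omega> \<in> space M. alive u n \<omega> \<noteq> {} \<and> card (alive u n \<omega>) \<le> K}
    \<le> prob (extinct u (Suc n))"
proof -
  \<comment> \<open>The set of alive cubes is random; the argument fixes its value \<open>V\<close>,
    for which the number of hits required is known, and sums over the finitely many values.\<close>
  define \<V> where "\<V> = {V :: ('n \<Rightarrow> nat) set. V \<subseteq> grid n \<and> V \<noteq> {} \<and> card V \<le> K}"
  define F where "F V = {\<omega> \<in> space M. alive u n \<omega> = V}" for V
  define G where "G V = F V \<inter> (\<Inter>k\<in>V. space M - void (hit_region u n k))" for V
  have fV: "finite \<V>" by (rule finite_subset[of _ "Pow (grid n)"]) (auto simp: \<V>_def)
  have F_ev [simp]: "F V \<in> events" for V unfolding F_def by (rule sets_alive)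
  have G_ev: "G V \<in> events" if "V \<in> \<V>" for V
    unfolding G_def using that hit_region_sets_scaled[OF t]
    by (intro sets.Int sets.finite_INT) (auto simp: \<V>_def intro: finite_subset)
  have 1: "hit_prob ^ K * prob (F V) \<le> prob (G V)" if V: "V \<in> \<V>" for V
  proof -
    have fin: "finite V" using V by (auto simp: \<V>_def intro: finite_subset)
    have "prob (G V) = prob (F V) * (\<Prod>k\<in>V. 1 - prob (void (hit_region u n k)))"
      unfolding G_def
    proof (rule prob_Int_not_void[OF fin, where R = "UNIV \<times> {top_radius n <..}"])
      show "F V \<in> sigma_sets (space M) (void_events (UNIV \<times> {top_radius n <..}))"
        unfolding F_def by (rule sets_Collect_alive)
      show "(UNIV \<times> {top_radius n <..}) \<inter> hit_region u n k = {}" for k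
        by (auto simp: hit_region_def)
    qed (use hit_region_sets_scaled[OF t] finite_hit_region[OF t] disjoint_hit_regions in auto)
    moreover have "hit_prob ^ K \<le> hit_prob ^ card V"
      using V hit_prob_bounds by (intro power_decreasing) (auto simp: \<V>_def)
    moreover have "hit_prob ^ card V \<le> (\<Prod>k\<in>V. 1 - prob (void (hit_region u n k)))"
      unfolding prod_constant[symmetric] using hit_prob_bounds(1) prob_hit[OF t]
      by (intro prod_mono) (auto simp: less_imp_le)
    ultimately show ?thesis
      by (simp add: mult.commute[of _ "prob (F V)"] mult_left_mono)
  qed
  have "prob {\<omega> \<in> space M. alive u n \<omega> \<noteq> {} \<and> card (alive u n \<omega>) \<le> K} = prob (\<Union>V\<in>\<V>. F V)"
    by (intro arg_cong[where f = prob]) (auto simp: \<V>_def F_def alive_def)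
  also have "\<dots> \<le> (\<Sum>V\<in>\<V>. prob (F V))"
    using fV by (intro finite_measure_subadditive_finite) auto
  finally have "hit_prob ^ K * prob {\<omega> \<in> space M. alive u n \<omega> \<noteq> {} \<and> card (alive u n \<omega>) \<le> K}
      \<le> hit_prob ^ K * (\<Sum>V\<in>\<V>. prob (F V))"
    using hit_prob_bounds(1) by (intro mult_left_mono) auto
  also have "\<dots> \<le> (\<Sum>V\<in>\<V>. prob (G V))"
    unfolding sum_distrib_left by (intro sum_mono 1)
  \<comment> \<open>The events \<open>G V\<close> lie in the pairwise disjoint events
    \<open>F V\<close>, so the sum is exactly the probability of the union.\<close>
  also have "\<dots> = prob (\<Union>V\<in>\<V>. G V)"
    using fV G_ev
    by (intro finite_measure_finite_Union[symmetric]) (auto simp: disjoint_family_on_def G_def F_def)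
  also have "prob (extinct u n) + \<dots> = prob (extinct u n \<union> (\<Union>V\<in>\<V>. G V))"
  proof (rule finite_measure_Union[symmetric])
    show "(\<Union>V\<in>\<V>. G V) \<in> events" using fV G_ev by blast
    show "extinct u n \<inter> (\<Union>V\<in>\<V>. G V) = {}" by (auto simp: extinct_def G_def F_def \<V>_def)
  qed (simp add: extinct_def sets_alive)
  also have "\<dots> \<le> prob (extinct u (Suc n))"
  proof (rule finite_measure_mono)
    show "extinct u n \<union> (\<Union>V\<in>\<V>. G V) \<subseteq> extinct u (Suc n)"
    proof
      fix \<omega> assume "\<omega> \<in> extinct u n \<union> (\<Union>V\<in>\<V>. G V)"
      then have "\<omega> \<in> space M" "\<And>k. k \<in> alive u n \<omega> \<Longrightarrow> \<omega> \<notin> void (hit_region u n k)"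
        by (auto simp: extinct_def G_def F_def simp del: INT_simps split: if_splits)
      then show "\<omega> \<in> extinct u (Suc n)"
        using alive_Suc_empty[OF t] by (simp add: extinct_def)
    qed
  qed (simp add: extinct_def sets_alive)
  finally show ?thesis by simp
qed

text \<open>Markov's inequality: at criticality a cube is alive with probability of order
  \<open>(2 ^ n) ^ -d\<close>, which cancels the number of cubes.\<close>

lemma prob_many_alive:
  assumes crit: "exponent = CARD('n)" and t: "top_radius n \<le> 1" and K: "0 < K"
  shows "prob {\<omega> \<in> space M. K < card (alive u n \<omega>)} \<le> (4 * b * CARD('n)) ^ CARD('n) * exp CARD('n) / K"
proof -
  let ?d = "CARD('n)" and ?t = "top_radius n"
  let ?E = "{\<omega> \<in> space M. K < card (alive u n \<omega>)}"
  have v: "prob (void (big_cone u n k)) \<le> (4 * b * ?d) ^ ?d / (2 ^ n) ^ ?d * exp ?d" for k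
  proof -
    \<comment> \<open>By the choice of \<open>top_radius\<close> the margin times the dimension is a
      quarter of it, so the exponential factor for the margin does not depend on
      \<open>n\<close>.\<close>
    have d: "real ?d * (b / 2 ^ n) = ?t / 4" by (simp add: top_radius_def)
    have "prob (void (big_cone u n k)) \<le> ?t powr exponent * exp (exponent * ?d * (b / 2 ^ n) / ?t)"
      unfolding big_cone_def
    proof (rule prob_void_cone_le)
      show "real ?d * (b / 2 ^ n) \<le> ?t" unfolding d using top_radius_pos[of n] by simp
    qed (use t top_radius_pos[of n] constants_pos in auto)
    also have "exponent * ?d * (b / 2 ^ n) / ?t = ?d * (1 / 4)"
      unfolding crit mult.assoc d using top_radius_pos[of n] by simp
    also have "exp (?d * (1 / 4)) \<le> exp ?d" by simp
    also have "?t powr exponent = (4 * b * ?d) ^ ?d / (2 ^ n) ^ ?d"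
      unfolding crit using top_radius_pos[of n] by (simp add: powr_realpow top_radius_def power_divide)
    finally show ?thesis using constants_pos by (simp add: mult_left_mono)
  qed
  have [simp]: "void (big_cone u n k) \<in> events" "void (big_cone u n k) \<inter> space M = void (big_cone u n k)" for k
    using void_sets[OF big_cone_sets] void_subset_space by auto
  have "real K * prob ?E = expectation (\<lambda>\<omega>. real K * indicator ?E \<omega>)"
    by (simp add: sets_alive)
  also have "\<dots> \<le> expectation (\<lambda>\<omega>. \<Sum>k\<in>grid n. indicator (void (big_cone u n k)) \<omega>)"
  proof (rule integral_mono)
    fix \<omega> assume "\<omega> \<in> space M"
    have "real (card (alive u n \<omega>)) = (\<Sum>k\<in>grid n. indicator (void (big_cone u n k)) \<omega>)"
      by (simp add: alive_def indicator_def sum.If_cases Int_def flip: sum.inter_filter)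
    then show "real K * indicator ?E \<omega> \<le> (\<Sum>k\<in>grid n. indicator (void (big_cone u n k)) \<omega>)"
      by (auto simp: indicator_def sum_nonneg simp flip: \<open>real (card (alive u n \<omega>)) = _\<close>)
  qed (auto simp: sets_alive less_top[symmetric] intro!: integrable_real_indicator Bochner_Integration.integrable_sum)
  also have "\<dots> = (\<Sum>k\<in>grid n. prob (void (big_cone u n k)))"
    by (subst Bochner_Integration.integral_sum) (auto simp: less_top[symmetric] intro!: integrable_real_indicator)
  also have "\<dots> \<le> (\<Sum>k\<in>(grid n :: ('n \<Rightarrow> nat) set). (4 * b * ?d) ^ ?d / (2 ^ n) ^ ?d * exp ?d)"
    by (intro sum_mono v)
  also have "\<dots> = (4 * b * ?d) ^ ?d * exp ?d"
    by (simp add: card_grid)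
  finally show ?thesis using K by (simp add: field_simps)
qed

lemma AE_extinct:
  assumes crit: "exponent = CARD('n)"
  shows "AE \<omega> in M. \<exists>n. alive u n \<omega> = {}"
proof -
  define C where "C = (4 * b * CARD('n)) ^ CARD('n) * exp (real CARD('n))"
  have C: "0 < C" using constants_pos by (simp add: C_def)
  \<comment> \<open>The extinction step needs radii up to \<open>top_radius n\<close> to occur in
    the model, so the sequence starts at a level where these are at most \<open>1\<close>.\<close>
  obtain n0 where n0: "\<And>n. n \<ge> n0 \<Longrightarrow> top_radius n \<le> 1"
    using eventually_top_radius_le_1 unfolding eventually_sequentially by auto
  define f where "f m = prob (extinct u (m + n0))" for m
  have step: "f m + hit_prob ^ K * prob {\<omega> \<in> space M. alive u (m + n0) \<omega> \<noteq> {} \<and> card (alive u (m + n0) \<omega>) \<le> K} \<le> f (Suc m)" for m K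
    using prob_extinct_Suc[OF n0, of "m + n0" u K] by (simp add: f_def)
  have "incseq f"
    using step hit_prob_bounds(1)
    by (intro incseq_SucI) (smt (verit) measure_nonneg mult_nonneg_nonneg zero_le_power)
  then obtain L where L: "f \<longlonglongrightarrow> L"
    using incseq_convergent[of f 1] by (auto simp: f_def)
  then have "(\<lambda>m. f (Suc m) - f m) \<longlonglongrightarrow> L - L"
    by (intro tendsto_diff LIMSEQ_Suc)
  then have diff: "(\<lambda>m. f (Suc m) - f m) \<longlonglongrightarrow> 0" by simp
  let ?A = "{\<omega> \<in> space M. \<exists>n. alive u n \<omega> = {}}"
  have A: "?A \<in> events" by (intro sets.sets_Collect_countable_Ex sets_alive)
  have "1 - e \<le> prob ?A" if e: "0 < e" for e
  proof -
    \<comment> \<open>The error \<open>e\<close> is split in two: \<open>K\<close> makes Markov's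
      bound \<open>C / K\<close> for many alive cubes smaller than \<open>e / 2\<close>, and then a
      level with a small increment does the same for few alive cubes.\<close>
    obtain K :: nat where K: "2 * C / e < K" using reals_Archimedean2 by blast
    have "0 < 2 * C / e" using C e by simp
    with K have K0: "0 < K" by (metis of_nat_0_less_iff order.strict_trans)
    have "0 < hit_prob ^ K * (e / 2)" using e hit_prob_bounds by simp
    with diff have "\<forall>\<^sub>F m in sequentially. f (Suc m) - f m < hit_prob ^ K * (e / 2)"
      by (rule order_tendstoD)
    then obtain m where m: "f (Suc m) - f m < hit_prob ^ K * (e / 2)"
      by (auto simp: eventually_sequentially)
    let ?n = "m + n0"
    let ?few = "{\<omega> \<in> space M. alive u ?n \<omega> \<noteq> {} \<and> card (alive u ?n \<omega>) \<le> K}"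
    let ?many = "{\<omega> \<in> space M. K < card (alive u ?n \<omega>)}"
    have "hit_prob ^ K * prob ?few < hit_prob ^ K * (e / 2)"
      using step[of m K] m by linarith
    then have few: "prob ?few < e / 2" using hit_prob_bounds by simp
    have "prob ?many \<le> C / K"
      using prob_many_alive[OF crit n0 K0, of ?n u] by (simp add: C_def)
    also have "\<dots> < e / 2" using K K0 e C by (simp add: field_simps)
    finally have many: "prob ?many < e / 2" .
    have "space M = extinct u ?n \<union> (?few \<union> ?many)" by (auto simp: extinct_def)
    then have "1 \<le> prob (extinct u ?n \<union> (?few \<union> ?many))" using prob_space by simp
    also have "\<dots> \<le> prob (extinct u ?n) + prob (?few \<union> ?many)"
      by (intro measure_Un_le sets.Un) (simp_all add: sets_alive extinct_def)
    also have "prob (?few \<union> ?many) \<le> prob ?few + prob ?many"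
      by (intro measure_Un_le) (simp_all add: sets_alive)
    finally have "1 - e \<le> prob (extinct u ?n)" using few many by simp
    also have "\<dots> \<le> prob ?A" by (intro finite_measure_mono A) (auto simp: extinct_def)
    finally show ?thesis .
  qed
  then have "1 \<le> prob ?A" by (meson field_le_epsilon diff_le_eq)
  then have "prob ?A = 1" using prob_le_1[of ?A] by linarith
  then show ?thesis by (simp add: prob_Collect_eq_1[OF A])
qed

text \<open>The half-open unit cubes with integer corners tile space. There are countably many, so
  almost surely each of them becomes extinct, at a level of its own.\<close>

lemma critical_covered:
  assumes crit: "exponent = CARD('n)"
  shows "\<P>(\<omega> in M. covered \<omega> = UNIV) = 1"
proof -
  let ?Z = "{u :: real ^ 'n. \<forall>i. u $ i \<in> \<int>}"
  have "countable ?Z"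
  proof -
    have "?Z \<subseteq> range (\<lambda>k. \<chi> i :: 'n. real_of_int (k i))"
    proof
      fix u :: "real^'n" assume "u \<in> ?Z"
      then have "u = (\<chi> i. real_of_int \<lfloor>u $ i\<rfloor>)" by (simp add: vec_eq_iff)
      then show "u \<in> range (\<lambda>k. \<chi> i :: 'n. real_of_int (k i))" by (metis rangeI)
    qed
    moreover have "countable (UNIV :: ('n \<Rightarrow> int) set)"
      using countable_PiE[of "UNIV :: 'n set" "\<lambda>_. UNIV :: int set"] by (simp add: PiE_UNIV_domain)
    ultimately show ?thesis by (meson countable_image countable_subset)
  qed
  then have "AE \<omega> in M. \<forall>u\<in>?Z. \<exists>n. alive u n \<omega> = {}"
    using AE_extinct[OF crit] by (subst AE_ball_countable) auto
  then have "AE \<omega> in M. covered \<omega> = UNIV"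
    using AE_space
  proof eventually_elim
    case (elim \<omega>)
    show "covered \<omega> = UNIV"
    proof (intro equalityI subset_UNIV subsetI)
      fix y :: "real ^ 'n"
      let ?u = "\<chi> i. real_of_int \<lfloor>y $ i\<rfloor>"
      obtain n where "alive ?u n \<omega> = {}" using elim(1) by force
      then show "y \<in> covered \<omega>" by (rule covered_cell[OF elim(2)]) simp_all
    qed
  qed
  then show ?thesis by (simp add: prob_Collect_eq_1[OF measurable_covered])
qed

end

section \<open>Subcritical intensities\<close>

text \<open>In place of the Cauchy-Schwarz inequality, the proof integrates \<open>2 * c * Z
  \<omega> \<le> (Z \<omega>)\<^sup>2 + c\<^sup>2 * indicator ?U \<omega>\<close>, which is a square
  on the union and trivial off it.\<close>

lemma (in prob_space) second_moment_method:
  assumes I: "finite I" and A: "\<And>i. i \<in> I \<Longrightarrow> A i \<in> events"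
    and C: "0 < C" and pos: "0 < (\<Sum>i\<in>I. prob (A i))"
    and bound: "(\<Sum>i\<in>I. \<Sum>j\<in>I. prob (A i \<inter> A j)) \<le> C * (\<Sum>i\<in>I. prob (A i))\<^sup>2"
  shows "1 / C \<le> prob (\<Union>i\<in>I. A i)"
proof -
  define Z where "Z \<omega> = (\<Sum>i\<in>I. indicator (A i) \<omega> :: real)" for \<omega>
  define e where "e = (\<Sum>i\<in>I. prob (A i))"
  \<comment> \<open>This choice optimises the resulting lower bound for the probability of the
    union.\<close>
  define c where "c = C * e"
  let ?U = "\<Union>i\<in>I. A i"
  have U: "?U \<in> events" using I A by auto
  have sub: "A i \<inter> space M = A i" if "i \<in> I" for i
    using sets.sets_into_space[OF A[OF that]] by auto
  have Z2: "(Z \<omega>)\<^sup>2 = (\<Sum>i\<in>I. \<Sum>j\<in>I. indicator (A i \<inter> A j) \<omega>)" for \<omega>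
    by (simp add: Z_def power2_eq_square sum_product indicator_inter_arith)
  have int1: "integrable M Z"
    unfolding Z_def using A
    by (intro Bochner_Integration.integrable_sum integrable_real_indicator) (auto simp: less_top[symmetric])
  have int2: "integrable M (\<lambda>\<omega>. (Z \<omega>)\<^sup>2)"
    unfolding Z2 using A
    by (intro Bochner_Integration.integrable_sum integrable_real_indicator) (auto simp: less_top[symmetric])
  have int3: "integrable M (\<lambda>\<omega>. c\<^sup>2 * indicator ?U \<omega>)"
    using U by (intro integrable_mult_right integrable_real_indicator) (auto simp: less_top[symmetric])
  have E1: "expectation Z = e"
    unfolding Z_def e_def using A sub
    by (subst Bochner_Integration.integral_sum) (auto simp: less_top[symmetric] intro!: sum.cong integrable_real_indicator)
  have "expectation (\<lambda>\<omega>. (Z \<omega>)\<^sup>2) = (\<Sum>i\<in>I. \<Sum>j\<in>I. prob (A i \<inter> A j \<inter> space M))"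
    unfolding Z2 using A
    by (simp add: Bochner_Integration.integral_sum Bochner_Integration.integrable_sum less_top[symmetric] sets.Int
        integrable_real_indicator)
  also have "\<dots> = (\<Sum>i\<in>I. \<Sum>j\<in>I. prob (A i \<inter> A j))"
    by (intro sum.cong refl) (simp add: Int_assoc sub)
  finally have E2: "expectation (\<lambda>\<omega>. (Z \<omega>)\<^sup>2) \<le> C * e\<^sup>2" using bound by (simp add: e_def)
  have "2 * c * e = expectation (\<lambda>\<omega>. 2 * c * Z \<omega>)" using E1 by simp
  also have "\<dots> \<le> expectation (\<lambda>\<omega>. (Z \<omega>)\<^sup>2 + c\<^sup>2 * indicator ?U \<omega>)"
  proof (rule integral_mono)
    fix \<omega> assume "\<omega> \<in> space M"
    show "2 * c * Z \<omega> \<le> (Z \<omega>)\<^sup>2 + c\<^sup>2 * indicator ?U \<omega>"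
    proof (cases "\<omega> \<in> ?U")
      case True
      have "0 \<le> (Z \<omega> - c)\<^sup>2" by simp
      then show ?thesis using True by (simp add: power2_diff algebra_simps)
    next
      case False
      then have "Z \<omega> = 0" by (auto simp: Z_def)
      then show ?thesis by simp
    qed
  qed (use int1 int2 int3 in auto)
  also have "\<dots> = expectation (\<lambda>\<omega>. (Z \<omega>)\<^sup>2) + c\<^sup>2 * prob ?U"
    using int2 int3 sets.sets_into_space[OF U] by (subst Bochner_Integration.integral_add) (auto simp: Int_absorb2)
  also have "\<dots> \<le> C * e\<^sup>2 + c\<^sup>2 * prob ?U" using E2 by simp
  finally have "C * e\<^sup>2 * 1 \<le> C * e\<^sup>2 * (C * prob ?U)"
    by (simp add: c_def power2_eq_square algebra_simps)
  moreover have "0 < C * e\<^sup>2" using C pos by (simp add: e_def)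
  ultimately have "1 \<le> C * prob ?U" by (simp only: mult_le_cancel_left_pos)
  then show ?thesis using C by (simp add: field_simps)
qed

text \<open>Distance in units of the mesh, on a dyadic scale. As the inequality is strict,
  \<open>near 0\<close> is equality.\<close>

definition near :: "nat \<Rightarrow> ('n \<Rightarrow> nat) \<Rightarrow> ('n \<Rightarrow> nat) \<Rightarrow> bool" where
  "near m k j \<longleftrightarrow> (\<forall>i. \<bar>int (k i) - int (j i)\<bar> < 2 ^ m)"

lemma card_near:
  fixes k :: "'n::finite \<Rightarrow> nat"
  shows "card {j \<in> grid n. near m k j} \<le> (2 * 2 ^ m) ^ CARD('n)"
proof -
  \<comment> \<open>The lower end is truncated at \<open>0\<close> by subtraction on naturals, which
    only shortens the interval; it has at most \<open>2 * 2 ^ m - 1\<close> elements.\<close>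
  let ?P = "PiE UNIV (\<lambda>i. {k i + 1 - 2 ^ m..<k i + 2 ^ m})"
  have "{j \<in> grid n. near m k j} \<subseteq> ?P"
  proof
    fix j assume j: "j \<in> {j \<in> grid n. near m k j}"
    have "j i \<in> {k i + 1 - 2 ^ m..<k i + 2 ^ m}" for i
    proof -
      define N :: nat where "N = 2 ^ m"
      have "\<bar>int (k i) - int (j i)\<bar> < int N" using j by (simp add: near_def N_def)
      then show ?thesis unfolding N_def[symmetric] by auto
    qed
    then show "j \<in> ?P" by (auto simp: PiE_UNIV_domain)
  qed
  then have "card {j \<in> grid n. near m k j} \<le> card ?P"
    by (intro card_mono finite_PiE) auto
  also have "\<dots> = (\<Prod>i\<in>(UNIV :: 'n set). card {k i + 1 - 2 ^ m..<k i + 2 ^ m})"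
    by (rule card_PiE) simp
  also have "\<dots> \<le> (\<Prod>i\<in>(UNIV :: 'n set). 2 * 2 ^ m)"
    by (intro prod_mono) auto
  finally show ?thesis by simp
qed

context fractal_model
begin

text \<open>Unlike in \<open>big_cone\<close> there is no margin: the grid points themselves, not
  cubes, are to remain uncovered.\<close>

definition small_cone :: "nat \<Rightarrow> ('n \<Rightarrow> nat) \<Rightarrow> ((real ^ 'n) \<times> real) set" where
  "small_cone n k = cone (grid_point 0 n k) 0 (1 / 2 ^ n) 1"

lemma void_small_cone_sets [simp]: "void (small_cone n k) \<in> events"
  unfolding small_cone_def by (intro void_sets cone_sets_scaled) auto

lemma prob_void_small_cone: "prob (void (small_cone n k)) = 1 / (2 powr exponent) ^ n"
proof -
  have "prob (void (small_cone n k)) = (1 / 2 ^ n) powr exponent"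
    unfolding small_cone_def by (subst prob_void_cone) auto
  also have "\<dots> = 1 / (2 powr exponent) ^ n"
    by (simp add: powr_divide powr_powr mult.commute flip: powr_realpow)
  finally show ?thesis .
qed

text \<open>The least scale \<open>m\<close> at which the two points are near determines their
  correlation. The bound sums over all scales at which they are near, so that the sum over
  \<open>j\<close> can later be carried out by counting near points.\<close>

lemma prob_void_two_small_cones:
  assumes k: "k \<in> grid n" and j: "j \<in> grid n"
  shows "prob (void (small_cone n k) \<inter> void (small_cone n j)) \<le>
    (\<Sum>m\<le>n. if near m k j
      then (4 * max a 1) powr exponent * (2 powr exponent) ^ (n - m) / (2 powr exponent) ^ (2 * n) else 0)"
proof -
  define \<beta> where "\<beta> = 2 powr exponent"
  define C where "C = (4 * max a 1) powr exponent"
  have \<beta>: "0 < \<beta>" by (simp add: \<beta>_def)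
  have C: "1 \<le> C" unfolding C_def using exponent_pos by (intro ge_one_powr_ge_zero) auto
  have near_n: "near n k j"
    unfolding near_def
  proof
    fix i
    define N :: nat where "N = 2 ^ n"
    have "k i < N" "j i < N"
      using k j by (auto simp: grid_def N_def)
    then have "\<bar>int (k i) - int (j i)\<bar> < int N" by linarith
    then show "\<bar>int (k i) - int (j i)\<bar> < 2 ^ n" by (simp add: N_def)
  qed
  define m where "m = (LEAST m. near m k j)"
  have m: "near m k j" unfolding m_def using near_n by (rule LeastI)
  have mn: "m \<le> n" unfolding m_def using near_n by (rule Least_le)
  have "prob (void (small_cone n k) \<inter> void (small_cone n j)) \<le> C * \<beta> ^ (n - m) / \<beta> ^ (2 * n)"
  proof (cases m)
    case 0
    \<comment> \<open>At scale \<open>0\<close> the two points coincide, and one void probability is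
      the required bound.\<close>
    have "prob (void (small_cone n k) \<inter> void (small_cone n j)) \<le> prob (void (small_cone n k))"
      by (intro finite_measure_mono) auto
    also have "\<dots> = 1 * \<beta> ^ (n - m) / \<beta> ^ (2 * n)"
      using 0 \<beta> by (simp add: prob_void_small_cone \<beta>_def[symmetric] mult_2 power_add)
    also have "\<dots> \<le> C * \<beta> ^ (n - m) / \<beta> ^ (2 * n)"
      using C \<beta> by (intro divide_right_mono mult_right_mono) auto
    finally show ?thesis .
  next
    case (Suc m')
    then have "\<not> near m' k j" unfolding m_def by (metis lessI not_less_Least)
    then obtain i where i: "2 ^ m' \<le> \<bar>int (k i) - int (j i)\<bar>" by (auto simp: near_def not_less)
    \<comment> \<open>With \<open>m = Suc m'\<close>, this makes \<open>2 * t * max a 1\<close>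
      equal to the separation \<open>2 ^ m' / 2 ^ n\<close> forced by the failure of
      \<open>near m'\<close>. The maximum with \<open>1\<close> keeps \<open>t\<close> at most
      \<open>1\<close>.\<close>
    define t where "t = 2 ^ m / (2 ^ n * (4 * max a 1))"
    let ?x = "grid_point 0 n k" and ?y = "grid_point 0 n j"
    have t0: "0 < t" by (simp add: t_def)
    have "(2 :: real) ^ m \<le> 2 ^ n" using mn by (intro power_increasing) auto
    also have "2 ^ n * 1 \<le> (2 ^ n * (4 * max a 1) :: real)" by (intro mult_left_mono) auto
    finally have "2 ^ m \<le> 2 ^ n * (4 * max a 1)" by simp
    then have t1: "t \<le> 1" by (simp add: t_def)
    have "2 * t * max a 1 = 2 ^ m' / 2 ^ n"
      using Suc by (simp add: t_def field_simps)
    also have "\<dots> \<le> \<bar>(?x - ?y) $ i\<bar>"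
    proof -
      have "real_of_int (2 ^ m') \<le> real_of_int \<bar>int (k i) - int (j i)\<bar>" using i by (simp only: of_int_le_iff)
      then have "2 ^ m' \<le> \<bar>real (k i) - real (j i)\<bar>" by simp
      moreover have "(?x - ?y) $ i = (real (k i) - real (j i)) / 2 ^ n"
        by (simp add: grid_point_def diff_divide_distrib)
      ultimately show ?thesis by (simp add: divide_right_mono)
    qed
    also have "\<dots> \<le> infnorm (?x - ?y)" by (rule component_le_infnorm_cart)
    also have "\<dots> \<le> a * \<nu> (?x - ?y)" by (rule infnorm_le)
    also have "\<dots> \<le> max a 1 * \<nu> (?x - ?y)" by (intro mult_right_mono) auto
    finally have "2 * t \<le> \<nu> (?x - ?y)"
      by (subst (asm) mult.commute, subst (asm) mult_le_cancel_left_pos) auto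
    then have "prob (void (small_cone n k) \<inter> void (small_cone n j)) \<le>
        (1 / 2 ^ n) powr (2 * exponent) * t powr (- exponent)"
      unfolding small_cone_def using t0 t1 by (intro prob_void_two_cones_le) auto
    also have "(1 / 2 ^ n) powr (2 * exponent) = 1 / \<beta> ^ (2 * n)"
      by (simp add: \<beta>_def powr_divide powr_powr ac_simps flip: powr_realpow)
    also have "t powr (- exponent) = C * \<beta> ^ (n - m)"
    proof -
      have "t powr (- exponent) = (1 / t) powr exponent"
        using t0 by (simp add: powr_minus powr_divide field_simps)
      also have "1 / t = (4 * max a 1) * 2 ^ (n - m)"
        using mn by (simp add: t_def power_diff)
      also have "\<dots> powr exponent = C * \<beta> ^ (n - m)"
        by (simp add: C_def \<beta>_def powr_mult powr_powr mult.commute flip: powr_realpow)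
      finally show ?thesis .
    qed
    finally show ?thesis by simp
  qed
  also have "\<dots> = (if near m k j then C * \<beta> ^ (n - m) / \<beta> ^ (2 * n) else 0)" using m by simp
  also have "\<dots> \<le> (\<Sum>m\<le>n. if near m k j then C * \<beta> ^ (n - m) / \<beta> ^ (2 * n) else 0)"
    using mn C \<beta> by (intro member_le_sum) auto
  finally show ?thesis unfolding C_def \<beta>_def .
qed

text \<open>At scale \<open>m\<close> there are at most \<open>D * D ^ m\<close> near points, each
  contributing a factor of order \<open>\<beta> ^ (n - m)\<close> relative to
  \<open>1 / \<beta> ^ (2 * n)\<close>. After division by \<open>D ^ n\<close> the scales form a
  geometric series.\<close>

lemma prob_some_void_small_cone:
  assumes sub: "exponent < CARD('n)"
  obtains C where "0 < C" "\<And>n. 1 / C \<le> prob (\<Union>k\<in>grid n. void (small_cone n k))"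
proof -
  define \<beta> where "\<beta> = 2 powr exponent"
  define D :: real where "D = 2 ^ CARD('n)"
  define C1 where "C1 = (4 * max a 1) powr exponent"
  \<comment> \<open>Subcriticality enters as \<open>q < 1\<close>: the number of grid points grows
    faster than the void probability of one of them decays.\<close>
  define q where "q = \<beta> / D"
  define C where "C = C1 * D / (1 - q)"
  have \<beta>: "0 < \<beta>" by (simp add: \<beta>_def)
  have D: "0 < D" by (simp add: D_def)
  have C1: "0 < C1" by (simp add: C1_def)
  have "\<beta> < 2 powr CARD('n)" unfolding \<beta>_def using sub by (intro powr_less_mono) auto
  then have q: "0 < q" "q < 1" using \<beta> by (simp_all add: q_def D_def powr_realpow)
  have C: "0 < C" using C1 D q by (simp add: C_def)
  have "1 / C \<le> prob (\<Union>k\<in>grid n. void (small_cone n k))" for n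
  proof (rule second_moment_method)
    have card: "real (card (grid n :: ('n \<Rightarrow> nat) set)) = D ^ n"
      by (simp add: card_grid D_def mult.commute flip: power_mult)
    have mean: "(\<Sum>k\<in>(grid n :: ('n \<Rightarrow> nat) set). prob (void (small_cone n k))) = D ^ n / \<beta> ^ n"
      by (simp add: prob_void_small_cone \<beta>_def[symmetric] card)
    then show "0 < (\<Sum>k\<in>(grid n :: ('n \<Rightarrow> nat) set). prob (void (small_cone n k)))"
      using D \<beta> by simp
    have inner: "(\<Sum>j\<in>grid n. prob (void (small_cone n k) \<inter> void (small_cone n j))) \<le> C * D ^ n / \<beta> ^ (2 * n)"
      if k: "k \<in> grid n" for k
    proof -
      have "(\<Sum>j\<in>grid n. prob (void (small_cone n k) \<inter> void (small_cone n j))) \<le>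
          (\<Sum>j\<in>grid n. \<Sum>m\<le>n. if near m k j then C1 * \<beta> ^ (n - m) / \<beta> ^ (2 * n) else 0)"
        unfolding C1_def \<beta>_def by (intro sum_mono prob_void_two_small_cones[OF k])
      also have "\<dots> = (\<Sum>m\<le>n. \<Sum>j\<in>grid n. if near m k j then C1 * \<beta> ^ (n - m) / \<beta> ^ (2 * n) else 0)"
        by (rule sum.swap)
      also have "\<dots> = (\<Sum>m\<le>n. real (card {j \<in> grid n. near m k j}) * (C1 * \<beta> ^ (n - m) / \<beta> ^ (2 * n)))"
        by (simp flip: sum.inter_filter)
      also have "\<dots> \<le> (\<Sum>m\<le>n. D * D ^ m * (C1 * \<beta> ^ (n - m) / \<beta> ^ (2 * n)))"
      proof (intro sum_mono mult_right_mono)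
        fix m
        have "real (card {j \<in> grid n. near m k j}) \<le> real ((2 * 2 ^ m) ^ CARD('n))"
          using card_near[of n m k] by (simp only: of_nat_le_iff)
        also have "\<dots> = D * D ^ m"
          by (simp add: D_def power_mult_distrib mult.commute flip: power_mult)
        finally show "real (card {j \<in> grid n. near m k j}) \<le> D * D ^ m" .
      qed (use C1 \<beta> in auto)
      also have "\<dots> = (\<Sum>m\<le>n. C1 * D * D ^ n / \<beta> ^ (2 * n) * q ^ (n - m))"
      proof (rule sum.cong[OF refl])
        fix m assume "m \<in> {..n}"
        then have "D ^ n = D ^ m * D ^ (n - m)" by (simp flip: power_add)
        then have "D ^ n * q ^ (n - m) = D ^ m * \<beta> ^ (n - m)"
          using D by (simp add: q_def power_divide)
        then show "D * D ^ m * (C1 * \<beta> ^ (n - m) / \<beta> ^ (2 * n)) = C1 * D * D ^ n / \<beta> ^ (2 * n) * q ^ (n - m)"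
          by (simp add: ac_simps)
      qed
      also have "\<dots> = C1 * D * D ^ n / \<beta> ^ (2 * n) * (\<Sum>m\<le>n. q ^ m)"
        unfolding sum_distrib_left[symmetric] by (subst sum.nat_diff_reindex[symmetric, of _ "Suc n", unfolded lessThan_Suc_atMost]) simp
      also have "\<dots> \<le> C1 * D * D ^ n / \<beta> ^ (2 * n) * (1 / (1 - q))"
      proof (rule mult_left_mono)
        show "(\<Sum>m\<le>n. q ^ m) \<le> 1 / (1 - q)"
          using q by (simp add: sum_gp0 divide_right_mono)
      qed (use C1 D \<beta> in auto)
      finally show ?thesis by (simp add: C_def mult.commute)
    qed
    have "(\<Sum>k\<in>grid n. \<Sum>j\<in>grid n. prob (void (small_cone n k) \<inter> void (small_cone n j))) \<le>
        (\<Sum>k\<in>(grid n :: ('n \<Rightarrow> nat) set). C * D ^ n / \<beta> ^ (2 * n))"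
      by (intro sum_mono inner)
    also have "\<dots> = C * (D ^ n / \<beta> ^ n)\<^sup>2"
      by (simp add: card power2_eq_square mult_2 power_add)
    finally show "(\<Sum>k\<in>grid n. \<Sum>j\<in>grid n. prob (void (small_cone n k) \<inter> void (small_cone n j))) \<le>
        C * (\<Sum>k\<in>(grid n :: ('n \<Rightarrow> nat) set). prob (void (small_cone n k)))\<^sup>2"
      unfolding mean .
  qed (use C in auto)
  then show thesis using that C by blast
qed

text \<open>Finitely many balls cover the closed unit cube. Once the mesh is below all their radii,
  the ball that contains a grid point belongs to the small cone of that point.\<close>

lemma covered_imp_eventually_no_void_small_cone:
  assumes \<omega>: "\<omega> \<in> space M" and cov: "covered \<omega> = UNIV"
  shows "\<exists>N. \<forall>n\<ge>N. \<omega> \<notin> (\<Union>k\<in>grid n. void (small_cone n k))"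
proof -
  have "cbox 0 One \<subseteq> (\<Union>p\<in>\<Phi> \<omega>. {y. \<nu> (y - fst p) < snd p})"
    using cov by (auto simp: covered_def case_prod_unfold)
  then obtain F where F: "F \<subseteq> \<Phi> \<omega>" "finite F" "cbox 0 One \<subseteq> (\<Union>p\<in>F. {y. \<nu> (y - fst p) < snd p})"
    by (rule compactE_image[OF compact_cbox open_nu_ball])
  have "\<forall>p\<in>F. \<forall>\<^sub>F n in sequentially. 1 / 2 ^ n < snd p"
  proof
    fix p assume "p \<in> F"
    then have "0 < snd p" using F(1) radius_bounds[OF \<omega>, of "fst p" "snd p"] by auto
    moreover have "(\<lambda>n. 1 / 2 ^ n :: real) \<longlonglongrightarrow> 0"
      using LIMSEQ_power_zero[of "1 / 2 :: real"] by (simp add: power_one_over)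
    ultimately show "\<forall>\<^sub>F n in sequentially. 1 / 2 ^ n < snd p" by (rule order_tendstoD(2)[rotated])
  qed
  then have "\<forall>\<^sub>F n in sequentially. \<forall>p\<in>F. 1 / 2 ^ n < snd p"
    using F(2) by (simp add: eventually_ball_finite)
  then obtain N where N: "\<And>n p. n \<ge> N \<Longrightarrow> p \<in> F \<Longrightarrow> 1 / 2 ^ n < snd p"
    unfolding eventually_sequentially by blast
  show ?thesis
  proof (intro exI allI impI notI)
    fix n assume n: "N \<le> n" and "\<omega> \<in> (\<Union>k\<in>grid n. void (small_cone n k))"
    then obtain k where k: "k \<in> grid n" "\<omega> \<in> void (small_cone n k)" by blast
    have One: "(One :: real^'n) $ i = 1" for i
      by (simp add: cart_eq_inner_axis axis_in_Basis_iff)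
    have "real (k i) \<le> 2 ^ n" for i
    proof -
      have "real (k i) \<le> real (2 ^ n)" using k(1) by (simp only: of_nat_le_iff) (simp add: grid_def less_imp_le)
      then show ?thesis by simp
    qed
    then have "grid_point 0 n k \<in> cbox 0 One"
      by (simp add: mem_box_cart One grid_point_def del: sum_component)
    then obtain p where p: "p \<in> F" "\<nu> (grid_point 0 n k - fst p) < snd p" using F(3) by blast
    then have "(fst p, snd p) \<in> small_cone n k"
      using N[OF n p(1)] F(1) radius_bounds[OF \<omega>, of "fst p" "snd p"]
      by (auto simp: small_cone_def cone_def commute)
    then show False using k(2) p(1) F(1) by (auto simp: void_def)
  qed
qed

text \<open>Coverage forces all small cones to be hit from some level \<open>N\<close> on. These
  events increase with \<open>N\<close> and have probability at most \<open>1 - 1 / C\<close>, and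
  so does their union.\<close>

lemma subcritical_not_covered:
  assumes "exponent < CARD('n)"
  shows "\<P>(\<omega> in M. covered \<omega> = UNIV) \<noteq> 1"
proof -
  obtain C where C: "0 < C" "\<And>n. 1 / C \<le> prob (\<Union>k\<in>grid n. void (small_cone n k))"
    using prob_some_void_small_cone[OF assms] by blast
  define W where "W n = space M - (\<Union>k\<in>grid n. void (small_cone n k))" for n
  define B where "B N = (\<Inter>n\<in>{N..}. W n)" for N
  have W_ev: "W n \<in> events" for n unfolding W_def
    by (intro sets.compl_sets sets.finite_UN) simp_all
  have B_ev: "B N \<in> events" for N unfolding B_def by (intro sets.countable_INT) (auto simp: W_ev)
  have "prob (B N) \<le> 1 - 1 / C" for N
  proof -
    have "prob (B N) \<le> prob (W N)" by (intro finite_measure_mono W_ev) (auto simp: B_def)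
    also have "\<dots> = 1 - prob (\<Union>k\<in>grid N. void (small_cone N k))"
      unfolding W_def by (intro prob_compl sets.finite_UN) auto
    finally show ?thesis using C(2)[of N] by linarith
  qed
  moreover have "(\<lambda>N. prob (B N)) \<longlonglongrightarrow> prob (\<Union>N. B N)"
  proof (rule finite_Lim_measure_incseq)
    show "range B \<subseteq> events" using B_ev by blast
    show "incseq B" by (auto simp: incseq_def B_def)
  qed
  ultimately have "prob (\<Union>N. B N) \<le> 1 - 1 / C" by (intro LIMSEQ_le_const2) auto
  moreover have "prob {\<omega> \<in> space M. covered \<omega> = UNIV} \<le> prob (\<Union>N. B N)"
  proof (rule finite_measure_mono)
    show "{\<omega> \<in> space M. covered \<omega> = UNIV} \<subseteq> (\<Union>N. B N)"
    proof
      fix \<omega> assume "\<omega> \<in> {\<omega> \<in> space M. covered \<omega> = UNIV}"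
      then have \<omega>: "\<omega> \<in> space M" "covered \<omega> = UNIV" by auto
      from covered_imp_eventually_no_void_small_cone[OF this] obtain N
        where "\<forall>n\<ge>N. \<omega> \<notin> (\<Union>k\<in>grid n. void (small_cone n k))" by blast
      then have "\<omega> \<in> B N" using \<omega>(1) by (auto simp: B_def W_def)
      then show "\<omega> \<in> (\<Union>N. B N)" by blast
    qed
  qed (use B_ev in auto)
  ultimately show ?thesis using C(1) by (smt (verit) divide_pos_pos)
qed

end

section \<open>Balls and boxes\<close>

lemma general_norm_norm: "general_norm (norm :: real ^ 'n \<Rightarrow> real) 1 (sqrt CARD('n))"
proof
  fix x y :: "real ^ 'n" and c :: real
  show "norm (x + y) \<le> norm x + norm y" by (rule norm_triangle_ineq)
  show "norm (c *\<^sub>R x) = \<bar>c\<bar> * norm x" by (rule norm_scaleR)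
  show "infnorm x \<le> 1 * norm x" by (simp add: infnorm_le_norm)
  show "norm x \<le> sqrt CARD('n) * infnorm x" using norm_le_infnorm[of x] by simp
qed

text \<open>The box of side \<open>r\<close> has half side \<open>r / 2\<close>; with the factor
  \<open>2\<close> it is the open ball of radius \<open>r\<close>.\<close>

lemma general_norm_infnorm: "general_norm (\<lambda>x :: real ^ 'n. 2 * infnorm x) (1 / 2) 2"
proof
  fix x y :: "real ^ 'n" and c :: real
  show "2 * infnorm (x + y) \<le> 2 * infnorm x + 2 * infnorm y" using infnorm_triangle[of x y] by linarith
  show "2 * infnorm (c *\<^sub>R x) = \<bar>c\<bar> * (2 * infnorm x)" by (simp add: infnorm_mul)
qed simp_all

lemma double_infnorm_less_iff:
  fixes x :: "real ^ 'n"
  shows "2 * infnorm x < t \<longleftrightarrow> (\<forall>i. - t / 2 < x $ i \<and> x $ i < t / 2)"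
proof -
  have "infnorm x < t / 2 \<longleftrightarrow> (\<forall>b\<in>Basis. \<bar>x \<bullet> b\<bar> < t / 2)"
    unfolding infnorm_Max by (subst Max_less_iff) auto
  also have "\<dots> \<longleftrightarrow> (\<forall>i. \<bar>x $ i\<bar> < t / 2)"
    by (auto simp: Basis_vec_def inner_axis)
  also have "\<dots> \<longleftrightarrow> (\<forall>i. - t / 2 < x $ i \<and> x $ i < t / 2)"
    by (intro all_cong1) linarith
  finally show ?thesis by auto
qed

lemma centred_box_eq: "centred_box x r = {y. 2 * infnorm (y - x) < r}"
proof -
  have "centred_box x r = {y. y - x \<in> box (\<chi> i. - r / 2) (\<chi> i. r / 2)}"
    unfolding centred_box_def by (force intro: image_eqI[of _ _ "y - x" for y])
  then show ?thesis by (simp add: mem_box_cart double_infnorm_less_iff)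
qed

lemma volume_infnorm: "general_norm.volume (\<lambda>x :: real ^ 'n. 2 * infnorm x) = 1"
proof -
  interpret general_norm "\<lambda>x :: real ^ 'n. 2 * infnorm x" "1 / 2" 2 by (rule general_norm_infnorm)
  have "{x :: real ^ 'n. 2 * infnorm x < 1} = box (- (1 / 2) *\<^sub>R One) ((1 / 2) *\<^sub>R One)"
    (is "?A = ?B")
  proof -
    have "One $ i = (1 :: real)" for i :: 'n
      by (simp add: cart_eq_inner_axis axis_in_Basis_iff)
    then show ?thesis
      by (simp add: double_infnorm_less_iff set_eq_iff mem_box_cart del: sum_component)
  qed
  moreover have "measure lborel ?B = 1"
    by (subst measure_lborel_box) (auto simp: inner_diff_left)
  ultimately show ?thesis by (simp add: volume_def)
qed

text \<open>The critical intensity is the least element of the set whose infimum is taken, so that no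
  monotonicity in the intensity is needed.\<close>

lemma critical_value:
  fixes \<nu> :: "real ^ 'n \<Rightarrow> real"
  assumes g: "general_norm \<nu> a b"
    and P: "\<And>l. 0 < l \<Longrightarrow> poisson_process (M l) (\<Phi> l) (scale_measure (ennreal l) fractal_measure)"
    and C: "\<And>l \<omega>. C l \<omega> = UNIV - (\<Union>(x, r)\<in>\<Phi> l \<omega>. {y. \<nu> (y - x) < r})"
  defines "lc \<equiv> real CARD('n) / general_norm.volume \<nu>"
  shows "existence_critical_value M C = lc" "\<P>(\<omega> in M lc. C lc \<omega> = {}) = 1"
proof -
  interpret general_norm \<nu> a b by (rule g)
  have lc: "0 < lc" using volume_pos by (simp add: lc_def)
  have gp: "fractal_model \<nu> a b l (M l) (\<Phi> l)" if "0 < l" for l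
    using g P[OF that] that by (simp add: fractal_model_def fractal_model_axioms_def)
  have empty: "C l \<omega> = {} \<longleftrightarrow> fractal_model.covered \<nu> (\<Phi> l) \<omega> = UNIV" if "0 < l" for l \<omega>
  proof -
    interpret fractal_model \<nu> a b l "M l" "\<Phi> l" by (rule gp[OF that])
    show ?thesis unfolding C covered_def by blast
  qed
  show 1: "\<P>(\<omega> in M lc. C lc \<omega> = {}) = 1"
  proof -
    interpret fractal_model \<nu> a b lc "M lc" "\<Phi> lc" by (rule gp[OF lc])
    show ?thesis
      unfolding empty[OF lc] using volume_pos by (intro critical_covered, unfold exponent_def) (simp add: lc_def)
  qed
  have 2: "lc \<le> l" if l: "0 < l" "\<P>(\<omega> in M l. C l \<omega> = {}) = 1" for l
  proof (rule ccontr)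
    assume "\<not> lc \<le> l"
    interpret fractal_model \<nu> a b l "M l" "\<Phi> l" by (rule gp[OF l(1)])
    have "exponent < CARD('n)"
      using \<open>\<not> lc \<le> l\<close> volume_pos by (simp add: exponent_def lc_def field_simps)
    then show False using subcritical_not_covered l(2) unfolding empty[OF l(1)] by blast
  qed
  show "existence_critical_value M C = lc"
    unfolding existence_critical_value_def by (rule cInf_eq_minimum) (use lc 1 2 in auto)
qed

theorem theorem1p1:
  fixes M :: "real \<Rightarrow> 'w measure"
    and \<Phi> :: "real \<Rightarrow> 'w \<Rightarrow> ((real ^ 'n) \<times> real) set"
  assumes "\<And>l. 0 < l \<Longrightarrow>
      poisson_process (M l) (\<Phi> l) (scale_measure (ennreal l) fractal_measure)"
  shows "lambda_e_ball M \<Phi> = real CARD('n) / measure lborel (ball (0 :: real ^ 'n) 1) \<and>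
    lambda_e_box M \<Phi> = real CARD('n) \<and>
    \<P>(\<omega> in M (lambda_e_box M \<Phi>). box_fractal (\<Phi> (lambda_e_box M \<Phi>) \<omega>) = {}) = 1 \<and>
    \<P>(\<omega> in M (lambda_e_ball M \<Phi>). ball_fractal (\<Phi> (lambda_e_ball M \<Phi>) \<omega>) = {}) = 1"
proof -
  have ball: "ball_fractal P = UNIV - (\<Union>(x, r)\<in>P. {y. norm (y - x) < r})" for P :: "((real ^ 'n) \<times> real) set"
    by (simp add: ball_fractal_def ball_def dist_norm norm_minus_commute)
  have box: "box_fractal P = UNIV - (\<Union>(x, r)\<in>P. {y. 2 * infnorm (y - x) < r})" for P :: "((real ^ 'n) \<times> real) set"
    by (simp add: box_fractal_def centred_box_eq)
  have "general_norm.volume (norm :: real ^ 'n \<Rightarrow> real) = measure lborel (ball (0 :: real ^ 'n) 1)"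
    by (simp add: general_norm.volume_def[OF general_norm_norm] ball_def)
  with critical_value[OF general_norm_norm assms ball] critical_value[OF general_norm_infnorm assms box]
  show ?thesis
    by (simp add: lambda_e_ball_def lambda_e_box_def volume_infnorm)
qed

end
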